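(* Let $\mathcal{F}_1\subset\mathcal{F}_2\subset\cdots\subset\mathcal{F}_k$ be closed convex parameter spaces and $T$ a linear functional. Then the estimator $\hat T^*$ constructed in the context satisfies, for some constant $C>0$ not depending on $n$, $$\sup_{f\in\mathcal{F}_1}E(\hat T^*-Tf)^2\le C\,\omega^2\!\left(\tfrac1{\sqrt n},\mathcal{F}_1\right),$$ and for $2\le i\le k$, $$\sup_{f\in\mathcal{F}_i}E(\hat T^*-Tf)^2\le C\left(\max_{1\le m\le i-1}\left\{\omega_+^2\!\left(\sqrt{\tfrac{\ln\gamma_{m,i,+}}n},\mathcal{F}_m,\mathcal{F}_i\right)\right\}+\omega^2\!\left(\tfrac1{\sqrt n},\mathcal{F}_i\right)\right).$$
   Context: White noise model: one observes $dY(t)=f(t)\,dt+\frac{1}{\sqrt n}\,dW(t)$, $-\frac12\le t\le\frac12$, where $W$ is a standard Brownian motion and $f\in L^2[-\frac12,\frac12]$ is unknown. Expectations and probabilities are taken under the true $f$. Parameter spaces are subsets of $L^2[-\frac12,\frac12]$; $T$ is a linear functional (not necessarily $L^2$-continuous) defined on the functions considered. A linear estimator is one of the form $a+\int k(t)\,dY(t)$ with $a\in\mathbb{R}$, $k\in L^2$ (a constant term is allowed). Moduli: $\omega(\varepsilon,\mathcal{F},\mathcal{H})=\sup\{Tg-Tf:\|g-f\|_2\le\varepsilon,\ f\in\mathcal{F},\ g\in\mathcal{H}\}$; $\omega_+(\varepsilon,\mathcal{F},\mathcal{H})=\sup\{|Tg-Tf|:\|g-f\|_2\le\varepsilon,\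 f\in\mathcal{F},\ g\in\mathcal{H}\}$; $\omega(\varepsilon,\mathcal{F})=\omega(\varepsilon,\mathcal{F},\mathcal{F})$. Quantities $\gamma$ and $A$. Write $i\wedge j=\min(i,j)$. For $i\ne j$, if $i\wedge j=1$, $$\gamma_{i,j}^2=\max\left(e,\frac{\omega^2(1/\sqrt n,\mathcal{F}_i,\mathcal{F}_j)}{\omega^2(1/\sqrt n,\mathcal{F}_1)}\right),\qquad \gamma_{i,j,+}^2=\max\left(e,\frac{\omega_+^2(1/\sqrt n,\mathcal{F}_i,\mathcal{F}_j)}{\omega^2(1/\sqrt n,\mathcal{F}_1)}\right).$$ $A_1^2(n)=\omega^2(\frac1{\sqrt n},\mathcal{F}_1)$ and, for $2\le i\le k$, $$A_i^2(n)=\max_{1\le m\le i-1}\left\{\omega_+^2\left(\sqrt{\tfrac{\ln\gamma_{m,i,+}}n},\mathcal{F}_m,\mathcal{F}_i\right)\right\}+\omega^2\left(\tfrac1{\sqrt n},\mathcal{F}_i\right).$$ If $i\wedge j\ge2$, recursively $$\gamma_{i,j}^2=\max\left(e,\frac{\omega^2(1/\sqrt n,\mathcal{F}_i,\mathcal{F}_j)}{A_{i\wedge j}^2(n)}\right),\qquad \gamma_{i,j,+}^2=\max\left(e,\frac{\omega_+^2(1/\sqrt n,\mathcal{F}_i,\mathcal{F}_j)}{A_{i\wedge j}^2(n)}\right).$$ All $A_i(n),\gamma_{i,j},\gamma_{i,j,+}$ are taken nonnegative. Construction of $\hat T^*$. For each $i$, $\hat T_i$ is a linear estimator with $\sup_{f\in\mathcal{F}_i}E(\hat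 T_i-Tf)^2\le\omega^2(\frac1{\sqrt n},\mathcal{F}_i)$. For $i\ne j$, $\hat T_{i,j}$ is a linear estimator such that, with $V=\frac1{\ln\gamma_{i,j}}\omega^2\left(\sqrt{\frac{\ln\gamma_{i,j}}n},\mathcal{F}_i,\mathcal{F}_j\right)$, $\mathrm{Var}(\hat T_{i,j})\le V$, $\sup_{f\in\mathcal{F}_i}(E\hat T_{i,j}-Tf)\le\frac12\sup_{\varepsilon>0}(\omega(\varepsilon,\mathcal{F}_i,\mathcal{F}_j)-\sqrt{nV}\,\varepsilon)$, $\inf_{f\in\mathcal{F}_j}(E\hat T_{i,j}-Tf)\ge-\frac12\sup_{\varepsilon>0}(\omega(\varepsilon,\mathcal{F}_i,\mathcal{F}_j)-\sqrt{nV}\,\varepsilon)$. (Such estimators are known to exist.) For $i\neq j$ let $b_{i,j}=\omega(\frac1{\sqrt n},\mathcal{F}_{i\wedge j})+\omega\left(\sqrt{\frac{\ln\gamma_{i,j}}n},\mathcal{F}_i,\mathcal{F}_j\right)$. For $i<j$ let $I_{i,j}$ be the indicator of the event $$\hat T_{i,j}-(4(2k)^{1/2}+1)b_{i,j}-4k^{1/2}A_j(n)\le\hat T_i\le\hat T_{j,i}+(4(2k)^{1/2}+1)b_{j,i}+4k^{1/2}A_j(n).$$ With $I_i=\prod_{j>i}I_{i,j}$ (empty products equal $1$, so $I_k=1$), the estimator uses $\hat T_i$ for the smallest $i$ with $I_i=1$: $$\hat T^*=\sum_{i=1}^k\Big(\prod_{m<i}(1-I_m)\Big)I_i\,\hat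 T_i .$$ *)

theory Defs
  imports "HOL-Probability.Probability"
begin

section \<open>The Hilbert space of square integrable functions on [-1/2, 1/2]\<close>

abbreviation time_interval :: "real set" where
  "time_interval \<equiv> {- (1/2) .. 1/2}"

definition square_integrable :: "(real \<Rightarrow> real) \<Rightarrow> bool" where
  "square_integrable f \<longleftrightarrow>
     f \<in> borel_measurable (lebesgue_on time_interval) \<and>
     integrable (lebesgue_on time_interval) (\<lambda>x. (f x)\<^sup>2)"

definition L2_rel :: "(real \<Rightarrow> real) \<Rightarrow> (real \<Rightarrow> real) \<Rightarrow> bool" where
  "L2_rel f g \<longleftrightarrow> square_integrable f \<and> square_integrable g \<and>
     (AE x in lebesgue_on time_interval. f x = g x)"

lemma square_integrable_mult:
  assumes "square_integrable f" "square_integrable g"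
  shows "integrable (lebesgue_on time_interval) (\<lambda>x. f x * g x)"
proof (rule Bochner_Integration.integrable_bound)
  show "integrable (lebesgue_on time_interval) (\<lambda>x. (f x)\<^sup>2 + (g x)\<^sup>2)"
    using assms by (auto simp: square_integrable_def)
  show "(\<lambda>x. f x * g x) \<in> borel_measurable (lebesgue_on time_interval)"
    using assms by (auto simp: square_integrable_def)
  have "\<bar>a * b\<bar> \<le> a\<^sup>2 + b\<^sup>2" for a b :: real
  proof -
    have "2 * (\<bar>a\<bar> * \<bar>b\<bar>) \<le> a\<^sup>2 + b\<^sup>2"
      using sum_squares_bound[of "\<bar>a\<bar>" "\<bar>b\<bar>"] by simp
    moreover have "0 \<le> \<bar>a\<bar> * \<bar>b\<bar>" by simp
    ultimately show ?thesis unfolding abs_mult by linarith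
  qed
  then show "AE x in lebesgue_on time_interval. norm (f x * g x) \<le> norm ((f x)\<^sup>2 + (g x)\<^sup>2)"
    by simp
qed

lemma square_integrable_zero: "square_integrable (\<lambda>x. 0)"
  by (simp add: square_integrable_def)

lemma square_integrable_scale:
  "square_integrable f \<Longrightarrow> square_integrable (\<lambda>x. c * f x)"
  by (auto simp: square_integrable_def power_mult_distrib intro!: borel_measurable_times)

lemma square_integrable_add:
  assumes "square_integrable f" "square_integrable g"
  shows "square_integrable (\<lambda>x. f x + g x)"
  using assms square_integrable_mult[OF assms]
  by (auto simp: square_integrable_def power2_sum mult.assoc)

lemma square_integrable_diff:
  assumes "square_integrable f" "square_integrable g"
  shows "square_integrable (\<lambda>x. f x - g x)"
  using square_integrable_add[OF assms(1) square_integrable_scale[OF assms(2), of "-1"]] by simp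

lemma square_integrable_indicator:
  "square_integrable (indicator {a<..b} :: real \<Rightarrow> real)"
proof -
  have "(\<lambda>x. (indicator {a<..b} x :: real)\<^sup>2) = indicator {a<..b}"
    by (auto simp: indicator_def)
  moreover have m: "(indicator {a<..b} :: real \<Rightarrow> real) \<in> borel_measurable (lebesgue_on time_interval)"
    by (intro measurable_restrict_space1 measurable_completion) simp
  moreover have "integrable (lebesgue_on time_interval) (indicator {a<..b} :: real \<Rightarrow> real)"
  proof (rule Bochner_Integration.integrable_bound[where f = "\<lambda>_. 1 :: real"])
    show "integrable (lebesgue_on time_interval) (\<lambda>_. 1 :: real)"
      by (intro finite_measure.integrable_const finite_measureI)
         (simp add: emeasure_restrict_space space_restrict_space)
  qed (use m in \<open>auto simp: indicator_def\<close>)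
  ultimately show ?thesis
    by (simp add: square_integrable_def)
qed

lemma L2_rel_map:
  assumes "L2_rel f g" "\<And>h. square_integrable h \<Longrightarrow> square_integrable (\<lambda>x. u (h x))"
  shows "L2_rel (\<lambda>x. u (f x)) (\<lambda>x. u (g x))"
proof -
  have "AE x in lebesgue_on time_interval. f x = g x"
    using assms(1) by (simp add: L2_rel_def)
  then have "AE x in lebesgue_on time_interval. u (f x) = u (g x)"
    by eventually_elim simp
  then show ?thesis
    using assms by (simp add: L2_rel_def)
qed

lemma L2_rel_map2:
  assumes "L2_rel f g" "L2_rel f' g'"
    and "\<And>h h'. square_integrable h \<Longrightarrow> square_integrable h' \<Longrightarrow> square_integrable (\<lambda>x. u (h x) (h' x))"
  shows "L2_rel (\<lambda>x. u (f x) (f' x)) (\<lambda>x. u (g x) (g' x))"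
proof -
  have "AE x in lebesgue_on time_interval. f x = g x" "AE x in lebesgue_on time_interval. f' x = g' x"
    using assms(1,2) by (simp_all add: L2_rel_def)
  then have "AE x in lebesgue_on time_interval. u (f x) (f' x) = u (g x) (g' x)"
    by eventually_elim simp
  then show ?thesis
    using assms by (simp add: L2_rel_def)
qed

quotient_type L2 = "real \<Rightarrow> real" / partial: L2_rel
proof (rule part_equivpI)
  show "\<exists>f. L2_rel f f"
    using square_integrable_zero by (auto simp: L2_rel_def)
  show "symp L2_rel"
    by (auto simp: symp_def L2_rel_def eq_commute)
  show "transp L2_rel"
  proof (rule transpI)
    fix f g h assume "L2_rel f g" "L2_rel g h"
    moreover from this have "AE x in lebesgue_on time_interval. f x = g x"
        "AE x in lebesgue_on time_interval. g x = h x"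
      by (simp_all add: L2_rel_def)
    then have "AE x in lebesgue_on time_interval. f x = h x"
      by eventually_elim simp
    ultimately show "L2_rel f h"
      by (simp add: L2_rel_def)
  qed
qed

instantiation L2 :: real_vector
begin

lift_definition zero_L2 :: L2 is "\<lambda>x. 0"
  by (simp add: L2_rel_def square_integrable_zero)

lift_definition plus_L2 :: "L2 \<Rightarrow> L2 \<Rightarrow> L2" is "\<lambda>f g x. f x + g x"
  by (rule L2_rel_map2) (auto intro: square_integrable_add)

lift_definition minus_L2 :: "L2 \<Rightarrow> L2 \<Rightarrow> L2" is "\<lambda>f g x. f x - g x"
  by (rule L2_rel_map2) (auto intro: square_integrable_diff)

lift_definition uminus_L2 :: "L2 \<Rightarrow> L2" is "\<lambda>f x. - f x"
  using square_integrable_scale[of _ "-1"] by (intro L2_rel_map[where u = uminus]) auto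

lift_definition scaleR_L2 :: "real \<Rightarrow> L2 \<Rightarrow> L2" is "\<lambda>c f x. c * f x"
  by (rule L2_rel_map) (auto intro: square_integrable_scale)

instance
proof
  fix a b c :: L2 and r s :: real
  show "a + b + c = a + (b + c)"
    by transfer (auto simp: L2_rel_def intro!: square_integrable_add)
  show "a + b = b + a"
    by transfer (auto simp: L2_rel_def intro!: square_integrable_add)
  show "0 + a = a"
    by transfer (auto simp: L2_rel_def)
  show "- a + a = 0"
    by transfer (auto simp: L2_rel_def square_integrable_zero)
  show "a - b = a + - b"
    by transfer (auto simp: L2_rel_def intro!: square_integrable_diff)
  show "r *\<^sub>R (a + b) = r *\<^sub>R a + r *\<^sub>R b"
    by transfer (auto simp: L2_rel_def algebra_simps intro!: square_integrable_add square_integrable_scale)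
  show "(r + s) *\<^sub>R a = r *\<^sub>R a + s *\<^sub>R a"
    by transfer (auto simp: L2_rel_def algebra_simps intro!: square_integrable_add square_integrable_scale)
  show "r *\<^sub>R s *\<^sub>R a = (r * s) *\<^sub>R a"
    by transfer (auto simp: L2_rel_def algebra_simps intro!: square_integrable_scale)
  show "1 *\<^sub>R a = a"
    by transfer (auto simp: L2_rel_def)
qed

end

instantiation L2 :: real_inner
begin

lift_definition inner_L2 :: "L2 \<Rightarrow> L2 \<Rightarrow> real" is
  "\<lambda>f g. \<integral>x. f x * g x \<partial>lebesgue_on time_interval"
proof -
  fix f f' g g' assume rel: "L2_rel f f'" "L2_rel g g'"
  show "(\<integral>x. f x * g x \<partial>lebesgue_on time_interval) = (\<integral>x. f' x * g' x \<partial>lebesgue_on time_interval)"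
  proof (rule integral_cong_AE)
    have "AE x in lebesgue_on time_interval. f x = f' x" "AE x in lebesgue_on time_interval. g x = g' x"
      using rel by (simp_all add: L2_rel_def)
    then show "AE x in lebesgue_on time_interval. f x * g x = f' x * g' x"
      by eventually_elim simp
  qed (use rel in \<open>auto simp: L2_rel_def square_integrable_def intro!: borel_measurable_times\<close>)
qed

definition norm_L2 :: "L2 \<Rightarrow> real" where
  "norm_L2 f = sqrt (inner f f)"

definition dist_L2 :: "L2 \<Rightarrow> L2 \<Rightarrow> real" where
  "dist_L2 f g = norm (f - g)"

definition sgn_L2 :: "L2 \<Rightarrow> L2" where
  "sgn_L2 f = f /\<^sub>R norm f"

definition uniformity_L2 :: "(L2 \<times> L2) filter" where
  "uniformity_L2 = (INF e\<in>{0<..}. principal {(x, y). dist x y < e})"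

definition open_L2 :: "L2 set \<Rightarrow> bool" where
  "open_L2 U \<longleftrightarrow> (\<forall>x\<in>U. eventually (\<lambda>(x', y). x' = x \<longrightarrow> y \<in> U) uniformity)"

instance
proof
  fix a b c :: L2 and r :: real and U :: "L2 set"
  show "dist a b = norm (a - b)" by (rule dist_L2_def)
  show "sgn a = a /\<^sub>R norm a" by (rule sgn_L2_def)
  show "uniformity = (INF e\<in>{0<..}. principal {(x, y :: L2). dist x y < e})"
    by (rule uniformity_L2_def)
  show "open U = (\<forall>x\<in>U. \<forall>\<^sub>F (x', y) in uniformity. x' = x \<longrightarrow> y \<in> U)"
    by (rule open_L2_def)
  show "norm a = sqrt (inner a a)" by (rule norm_L2_def)
  show "inner a b = inner b a"
    by transfer (simp add: mult.commute)
  show "inner (a + b) c = inner a c + inner b c"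
    by transfer (simp add: L2_rel_def distrib_right square_integrable_mult)
  show "inner (r *\<^sub>R a) b = r * inner a b"
    by transfer (simp add: mult.assoc)
  show "0 \<le> inner a a"
    by transfer simp
  show "(inner a a = 0) = (a = 0)"
  proof transfer
    fix f assume "L2_rel f f"
    then have f: "square_integrable f" by (simp add: L2_rel_def)
    have "(\<integral>x. f x * f x \<partial>lebesgue_on time_interval) = 0 \<longleftrightarrow>
        (AE x in lebesgue_on time_interval. f x * f x = 0)"
      using square_integrable_mult[OF f f] by (intro integral_nonneg_eq_0_iff_AE) auto
    then show "((\<integral>x. f x * f x \<partial>lebesgue_on time_interval) = 0) = L2_rel f (\<lambda>x. 0)"
      using f by (simp add: L2_rel_def square_integrable_zero)
  qed
qed

end

text \<open>A step function is represented by a list of triples \<open>(a, b, c)\<close>, each standing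
  for \<open>c\<close> times the indicator of \<open>{a<..b}\<close>; the intervals may overlap.\<close>

type_synonym step_fun = "(real \<times> real \<times> real) list"

definition step_on_interval :: "step_fun \<Rightarrow> bool" where
  "step_on_interval \<phi> \<longleftrightarrow> (\<forall>(a, b, c)\<in>set \<phi>. - (1/2) \<le> a \<and> a \<le> b \<and> b \<le> 1/2)"

lift_definition step_L2 :: "step_fun \<Rightarrow> L2" is
  "\<lambda>\<phi> x. \<Sum>(a, b, c)\<leftarrow>\<phi>. c * indicator {a<..b} x"
proof -
  fix \<phi> :: step_fun
  have "square_integrable (\<lambda>x. \<Sum>(a, b, c)\<leftarrow>\<phi>. c * indicator {a<..b} x)"
  proof (induction \<phi>)
    case Nil
    show ?case by (simp add: square_integrable_zero)
  next
    case (Cons s \<phi>)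
    then show ?case
      by (cases s) (simp add: square_integrable_add square_integrable_scale square_integrable_indicator)
  qed
  then show "L2_rel (\<lambda>x. \<Sum>(a, b, c)\<leftarrow>\<phi>. c * indicator {a<..b} x)
      (\<lambda>x. \<Sum>(a, b, c)\<leftarrow>\<phi>. c * indicator {a<..b} x)"
    by (simp add: L2_rel_def)
qed

lift_definition drift :: "L2 \<Rightarrow> real \<Rightarrow> real" is
  "\<lambda>f t. \<integral>s. indicator {..t} s * f s \<partial>lebesgue_on time_interval"
proof
  fix f g :: "real \<Rightarrow> real" and t :: real
  assume fg: "L2_rel f g"
  have ind: "(indicator {..t} :: real \<Rightarrow> real) \<in> borel_measurable (lebesgue_on time_interval)"
    by (intro measurable_restrict_space1 measurable_completion) simp
  show "(\<integral>s. indicator {..t} s * f s \<partial>lebesgue_on time_interval) =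
      (\<integral>s. indicator {..t} s * g s \<partial>lebesgue_on time_interval)"
  proof (rule integral_cong_AE)
    have "AE s in lebesgue_on time_interval. f s = g s"
      using fg by (simp add: L2_rel_def)
    then show "AE s in lebesgue_on time_interval. indicator {..t} s * f s = indicator {..t} s * g s"
      by eventually_elim simp
  qed (use fg ind in \<open>auto simp: L2_rel_def square_integrable_def intro!: borel_measurable_times\<close>)
qed

section \<open>The white noise model and linear estimators\<close>

definition standard_brownian_motion :: "'w measure \<Rightarrow> (real \<Rightarrow> 'w \<Rightarrow> real) \<Rightarrow> bool" where
  "standard_brownian_motion M W \<longleftrightarrow>
     prob_space M \<and>
     (\<forall>t\<in>time_interval. W t \<in> borel_measurable M) \<and>
     (AE \<omega> in M. W (- (1/2)) \<omega> = 0) \<and>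
     (\<forall>s\<in>time_interval. \<forall>t\<in>time_interval. s < t \<longrightarrow>
        distributed M lborel (\<lambda>\<omega>. W t \<omega> - W s \<omega>) (normal_density 0 (sqrt (t - s)))) \<and>
     (\<forall>ts. sorted ts \<and> set ts \<subseteq> time_interval \<longrightarrow>
        prob_space.indep_vars M (\<lambda>_. borel)
          (\<lambda>i \<omega>. W (ts ! Suc i) \<omega> - W (ts ! i) \<omega>) {..<length ts - 1}) \<and>
     (AE \<omega> in M. continuous_on time_interval (\<lambda>t. W t \<omega>))"

text \<open>The observed path \<open>Y\<close> with \<open>dY(t) = f(t) dt + dW(t) / sqrt n\<close> under the true
  function \<open>f\<close>.\<close>

definition observation :: "(real \<Rightarrow> 'w \<Rightarrow> real) \<Rightarrow> nat \<Rightarrow> L2 \<Rightarrow> real \<Rightarrow> 'w \<Rightarrow> real" where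
  "observation W n f t \<omega> = drift f t + W t \<omega> / sqrt (real n)"

definition step_integral :: "step_fun \<Rightarrow> (real \<Rightarrow> 'w \<Rightarrow> real) \<Rightarrow> 'w \<Rightarrow> real" where
  "step_integral \<phi> Y \<omega> = (\<Sum>(a, b, c)\<leftarrow>\<phi>. c * (Y b \<omega> - Y a \<omega>))"

text \<open>\<open>X\<close> is a version of the Wiener integral of \<open>h\<close> against \<open>dY\<close>: the mean square limit of
  the integrals of step functions converging to \<open>h\<close>. It is unique almost surely.\<close>

definition has_wiener_integral ::
  "'w measure \<Rightarrow> (real \<Rightarrow> 'w \<Rightarrow> real) \<Rightarrow> L2 \<Rightarrow> ('w \<Rightarrow> real) \<Rightarrow> bool" where
  "has_wiener_integral M Y h X \<longleftrightarrow>
     X \<in> borel_measurable M \<and>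
     (\<exists>\<phi> :: nat \<Rightarrow> step_fun.
        (\<forall>m. step_on_interval (\<phi> m)) \<and>
        (\<lambda>m. step_L2 (\<phi> m)) \<longlonglongrightarrow> h \<and>
        (\<lambda>m. \<integral>\<^sup>+\<omega>. ennreal ((step_integral (\<phi> m) Y \<omega> - X \<omega>)\<^sup>2) \<partial>M) \<longlonglongrightarrow> 0)"

text \<open>An estimator is a function of the observed path, whose law depends on the true
  function; it is represented by its value at each true \<open>f\<close> and each outcome \<open>\<omega>\<close> of the noise.
  Expectations under \<open>f\<close> are thus integrals over \<open>\<omega>\<close> with \<open>f\<close> fixed. For a linear estimator
  \<open>a\<close> and \<open>h\<close> must not depend on \<open>f\<close>.\<close>

type_synonym 'w estimator = "L2 \<Rightarrow> 'w \<Rightarrow> real"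

definition linear_estimator ::
  "'w measure \<Rightarrow> (real \<Rightarrow> 'w \<Rightarrow> real) \<Rightarrow> nat \<Rightarrow> 'w estimator \<Rightarrow> bool" where
  "linear_estimator M W n X \<longleftrightarrow>
     (\<exists>a h. \<forall>f. has_wiener_integral M (observation W n f) h (\<lambda>\<omega>. X f \<omega> - a))"

definition mse :: "'w measure \<Rightarrow> (L2 \<Rightarrow> real) \<Rightarrow> 'w estimator \<Rightarrow> L2 \<Rightarrow> ennreal" where
  "mse M T X f = (\<integral>\<^sup>+\<omega>. ennreal ((X f \<omega> - T f)\<^sup>2) \<partial>M)"

section \<open>Linear functionals and moduli of continuity\<close>

definition linear_functional_on :: "L2 set \<Rightarrow> (L2 \<Rightarrow> real) \<Rightarrow> bool" where
  "linear_functional_on D T \<longleftrightarrow> subspace D \<and>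
     (\<forall>f\<in>D. \<forall>g\<in>D. T (f + g) = T f + T g) \<and> (\<forall>c. \<forall>f\<in>D. T (c *\<^sub>R f) = c * T f)"

definition modulus_diffs :: "(L2 \<Rightarrow> real) \<Rightarrow> real \<Rightarrow> L2 set \<Rightarrow> L2 set \<Rightarrow> real set" where
  "modulus_diffs T \<epsilon> F H = {T g - T f | f g. norm (g - f) \<le> \<epsilon> \<and> f \<in> F \<and> g \<in> H}"

text \<open>These suprema are over the reals, hence meaningful only for nonempty sets of differences
  that are bounded above.\<close>

definition omega :: "(L2 \<Rightarrow> real) \<Rightarrow> real \<Rightarrow> L2 set \<Rightarrow> L2 set \<Rightarrow> real" where
  "omega T \<epsilon> F H = Sup (modulus_diffs T \<epsilon> F H)"

definition omega_plus :: "(L2 \<Rightarrow> real) \<Rightarrow> real \<Rightarrow> L2 set \<Rightarrow> L2 set \<Rightarrow> real" where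
  "omega_plus T \<epsilon> F H = Sup (abs ` modulus_diffs T \<epsilon> F H)"

text \<open>The quantities \<open>rate i = A\<^sub>i(n)\<close> and \<open>\<gamma>\<^sub>+ i j\<close>. The case \<open>min i j = 1\<close> of \<open>gamma_plus\<close> needs no
  separate clause because \<open>rate 1\<close> is \<open>\<omega>(1 / sqrt n, F 1)\<close>; the index \<open>0\<close> is not used.\<close>

function rate :: "(L2 \<Rightarrow> real) \<Rightarrow> (nat \<Rightarrow> L2 set) \<Rightarrow> nat \<Rightarrow> nat \<Rightarrow> real"
  and gamma_plus :: "(L2 \<Rightarrow> real) \<Rightarrow> (nat \<Rightarrow> L2 set) \<Rightarrow> nat \<Rightarrow> nat \<Rightarrow> nat \<Rightarrow> real"
where
  "rate T F n i =
     (if i \<le> 1 then omega T (1 / sqrt n) (F 1) (F 1)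
      else sqrt ((MAX m\<in>{1..i - 1}.
                    (omega_plus T (sqrt (ln (gamma_plus T F n m i) / n)) (F m) (F i))\<^sup>2)
                 + (omega T (1 / sqrt n) (F i) (F i))\<^sup>2))"
| "gamma_plus T F n i j =
     sqrt (max (exp 1) ((omega_plus T (1 / sqrt n) (F i) (F j))\<^sup>2 / (rate T F n (min i j))\<^sup>2))"
  by pat_completeness auto
termination
  by (relation "Wellfounded.measure (\<lambda>x. case x of Inl (T, F, n, i) \<Rightarrow> 2 * i
        | Inr (T, F, n, i, j) \<Rightarrow> 2 * min i j + 1)") auto

declare rate.simps [simp del] gamma_plus.simps [simp del]

definition gamma :: "(L2 \<Rightarrow> real) \<Rightarrow> (nat \<Rightarrow> L2 set) \<Rightarrow> nat \<Rightarrow> nat \<Rightarrow> nat \<Rightarrow> real" where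
  "gamma T F n i j =
     sqrt (max (exp 1) ((omega T (1 / sqrt n) (F i) (F j))\<^sup>2 / (rate T F n (min i j))\<^sup>2))"

section \<open>The adaptive estimator\<close>

definition var_bound :: "(L2 \<Rightarrow> real) \<Rightarrow> (nat \<Rightarrow> L2 set) \<Rightarrow> nat \<Rightarrow> nat \<Rightarrow> nat \<Rightarrow> real" where
  "var_bound T F n i j =
     1 / ln (gamma T F n i j) * (omega T (sqrt (ln (gamma T F n i j) / n)) (F i) (F j))\<^sup>2"

definition bias_bound :: "(L2 \<Rightarrow> real) \<Rightarrow> (nat \<Rightarrow> L2 set) \<Rightarrow> nat \<Rightarrow> nat \<Rightarrow> nat \<Rightarrow> real" where
  "bias_bound T F n i j =
     1/2 * (SUP \<epsilon>\<in>{0<..}. omega T \<epsilon> (F i) (F j) - sqrt (n * var_bound T F n i j) * \<epsilon>)"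

definition building_blocks ::
  "'w measure \<Rightarrow> (real \<Rightarrow> 'w \<Rightarrow> real) \<Rightarrow> (L2 \<Rightarrow> real) \<Rightarrow> (nat \<Rightarrow> L2 set) \<Rightarrow> nat \<Rightarrow> nat \<Rightarrow>
   (nat \<Rightarrow> 'w estimator) \<Rightarrow> (nat \<Rightarrow> nat \<Rightarrow> 'w estimator) \<Rightarrow> bool"
where
  "building_blocks M W T F k n T1 T2 \<longleftrightarrow>
     (\<forall>i\<in>{1..k}. linear_estimator M W n (T1 i) \<and>
        (SUP f\<in>F i. mse M T (T1 i) f) \<le> ennreal ((omega T (1 / sqrt n) (F i) (F i))\<^sup>2)) \<and>
     (\<forall>i\<in>{1..k}. \<forall>j\<in>{1..k}. i \<noteq> j \<longrightarrow>
        linear_estimator M W n (T2 i j) \<and>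
        (\<forall>f. prob_space.variance M (T2 i j f) \<le> var_bound T F n i j) \<and>
        (\<forall>f\<in>F i. prob_space.expectation M (T2 i j f) - T f \<le> bias_bound T F n i j) \<and>
        (\<forall>f\<in>F j. prob_space.expectation M (T2 i j f) - T f \<ge> - bias_bound T F n i j))"

definition band :: "(L2 \<Rightarrow> real) \<Rightarrow> (nat \<Rightarrow> L2 set) \<Rightarrow> nat \<Rightarrow> nat \<Rightarrow> nat \<Rightarrow> real" where
  "band T F n i j =
     omega T (1 / sqrt n) (F (min i j)) (F (min i j)) +
     omega T (sqrt (ln (gamma T F n i j) / n)) (F i) (F j)"

definition pair_indicator ::
  "(L2 \<Rightarrow> real) \<Rightarrow> (nat \<Rightarrow> L2 set) \<Rightarrow> nat \<Rightarrow> nat \<Rightarrow>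
   (nat \<Rightarrow> 'w estimator) \<Rightarrow> (nat \<Rightarrow> nat \<Rightarrow> 'w estimator) \<Rightarrow> nat \<Rightarrow> nat \<Rightarrow> 'w estimator"
where
  "pair_indicator T F k n T1 T2 i j f \<omega> = of_bool
     (T2 i j f \<omega> - (4 * sqrt (2 * k) + 1) * band T F n i j - 4 * sqrt k * rate T F n j \<le> T1 i f \<omega> \<and>
      T1 i f \<omega> \<le> T2 j i f \<omega> + (4 * sqrt (2 * k) + 1) * band T F n j i + 4 * sqrt k * rate T F n j)"

definition all_indicator ::
  "(L2 \<Rightarrow> real) \<Rightarrow> (nat \<Rightarrow> L2 set) \<Rightarrow> nat \<Rightarrow> nat \<Rightarrow>
   (nat \<Rightarrow> 'w estimator) \<Rightarrow> (nat \<Rightarrow> nat \<Rightarrow> 'w estimator) \<Rightarrow> nat \<Rightarrow> 'w estimator"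
where
  "all_indicator T F k n T1 T2 i f \<omega> = (\<Prod>j\<in>{i<..k}. pair_indicator T F k n T1 T2 i j f \<omega>)"

definition T_star ::
  "(L2 \<Rightarrow> real) \<Rightarrow> (nat \<Rightarrow> L2 set) \<Rightarrow> nat \<Rightarrow> nat \<Rightarrow>
   (nat \<Rightarrow> 'w estimator) \<Rightarrow> (nat \<Rightarrow> nat \<Rightarrow> 'w estimator) \<Rightarrow> 'w estimator"
where
  "T_star T F k n T1 T2 f \<omega> =
     (\<Sum>i = 1..k. (\<Prod>m = 1..<i. 1 - all_indicator T F k n T1 T2 m f \<omega>) *
        all_indicator T F k n T1 T2 i f \<omega> * T1 i f \<omega>)"

end

theory Submission
  imports Defs
begin

text \<open>Wiener integrals are mean square limits of Gaussian step integrals, so by Fatou every linear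
  estimator is sub-Gaussian around its mean with its own variance. Scaling differences inside the
  larger space bounds bias, variance and band width of \<open>T2 i j\<close> by multiples of \<open>A\<^sub>m\<close> with
  \<open>m = max i j\<close>. Let \<open>f \<in> F i\<close>. If a space \<open>j < i\<close> is selected, its acceptance against \<open>i\<close> forces the
  error to be of order \<open>A\<^sub>i\<close>. If \<open>j > i\<close> is selected, all spaces \<open>s\<close> with \<open>i \<le> s < j\<close> were rejected;
  rejection of a correct \<open>s\<close> by some \<open>m\<close> has probability at most of order \<open>(A\<^sub>s / A\<^sub>m)\<^bsup>4k\<^esup>\<close>, and for one \<open>s\<close> the
  jump \<open>A\<^sub>s\<^sub>+\<^sub>1 / A\<^sub>s\<close> is at least the geometric mean of the jumps between \<open>i\<close> and \<open>j\<close>. So selecting \<open>j\<close>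
  has probability at most of order \<open>(A\<^sub>i / A\<^sub>j)\<^sup>4\<close>, which offsets the fourth moment \<open>A\<^sub>j\<^sup>4\<close> of the error.\<close>

section \<open>Sub-Gaussian variables\<close>

text \<open>The exponent 4 k explains the thresholds. Rejection of \<open>s = i\<close> alone is
  governed by the nearest competitor \<open>i + 1\<close>, and \<open>A i / A (i + 1)\<close> may be
  close to 1 while \<open>A j\<close> is huge, so only the best \<open>s\<close> on the way to
  \<open>j\<close> gives a useful bound. Its ratio is controlled only in the power
  \<open>j - i\<close>, which can be \<open>k - 1\<close>, and a fourth power has to survive; this
  asks for deviations of order \<open>sqrt k * A m\<close>, which is the slack
  \<open>4 * sqrt k * A m\<close>, half of it for \<open>T1\<close> and half for \<open>T2\<close>.
  The other obstacle is that the standard deviation of \<open>T2\<close> is comparable with the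
  smaller rate \<open>A s\<close> only up to a factor \<gamma>. The term
  \<open>4 * sqrt (2 * k)\<close> times \<Omega> in the band pays for it: \<Omega>^2 is ln \<gamma>
  times the variance bound, so this term contributes \<gamma>^(-16 k), which absorbs the loss
  \<gamma>^(4 k). The building blocks all depend on the same noise, so only marginal tails and union
  bounds enter, and every constant depends on \<open>k\<close> alone.\<close>

definition subgaussian :: "'w measure \<Rightarrow> ('w \<Rightarrow> real) \<Rightarrow> real \<Rightarrow> bool" where
  "subgaussian M Z v \<longleftrightarrow> Z \<in> borel_measurable M \<and>
     (\<forall>t. (\<integral>\<^sup>+\<omega>. ennreal (exp (t * Z \<omega>)) \<partial>M) \<le> ennreal (exp (t\<^sup>2 * v / 2)))"

lemma subgaussian_mono:
  assumes "subgaussian M Z v" "v \<le> v'"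
  shows "subgaussian M Z v'"
proof -
  have "ennreal (exp (t\<^sup>2 * v / 2)) \<le> ennreal (exp (t\<^sup>2 * v' / 2))" for t
    using assms(2) by (intro ennreal_leI) (simp add: mult_left_mono)
  with assms(1) show ?thesis
    unfolding subgaussian_def by (blast intro: order_trans)
qed

lemma subgaussian_uminus:
  assumes "subgaussian M Z v"
  shows "subgaussian M (\<lambda>\<omega>. - Z \<omega>) v"
proof -
  have "(\<integral>\<^sup>+\<omega>. ennreal (exp (t * - Z \<omega>)) \<partial>M) \<le> ennreal (exp (t\<^sup>2 * v / 2))" for t
    using assms[unfolded subgaussian_def, THEN conjunct2, rule_format, of "- t"] by simp
  with assms show ?thesis
    unfolding subgaussian_def by simp
qed

text \<open>Chernoff's bound at \<open>s = x / v\<close>, the minimiser of the exponent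
  \<open>- s * x + s^2 * v / 2\<close>.\<close>

lemma subgaussian_tail:
  assumes Z: "subgaussian M Z v" and "0 < v" "0 < x"
  shows "emeasure M {\<omega>\<in>space M. x \<le> Z \<omega>} \<le> ennreal (exp (- (x\<^sup>2 / (2 * v))))"
proof -
  define s where "s = x / v"
  have s: "0 < s" using assms by (simp add: s_def)
  have [measurable]: "Z \<in> borel_measurable M" using Z by (simp add: subgaussian_def)
  have "emeasure M {\<omega>\<in>space M. x \<le> Z \<omega>}
      \<le> ennreal (exp (- s * x)) * (\<integral>\<^sup>+\<omega>. ennreal (exp (s * Z \<omega>)) * indicator (space M) \<omega> \<partial>M)"
    by (rule Chernoff_ineq_nn_integral_ge[OF s]) auto
  also have "(\<integral>\<^sup>+\<omega>. ennreal (exp (s * Z \<omega>)) * indicator (space M) \<omega> \<partial>M) = (\<integral>\<^sup>+\<omega>. ennreal (exp (s * Z \<omega>)) \<partial>M)"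
    by (rule nn_integral_cong) simp
  also have "ennreal (exp (- s * x)) * \<dots> \<le> ennreal (exp (- s * x)) * ennreal (exp (s\<^sup>2 * v / 2))"
    using Z by (intro mult_left_mono) (auto simp: subgaussian_def)
  also have "\<dots> = ennreal (exp (- s * x + s\<^sup>2 * v / 2))"
    by (simp add: ennreal_mult'[symmetric] mult_exp_exp)
  also have "- s * x + s\<^sup>2 * v / 2 = - (x\<^sup>2 / (2 * v))"
    using \<open>0 < v\<close> by (simp add: s_def field_simps power2_eq_square)
  finally show ?thesis .
qed

text \<open>For nonnegative \<open>y\<close> the quantity \<open>y ^ 4 / 24\<close> is one term of
  the exponential series; the second exponential serves negative \<open>y\<close>.\<close>

lemma power4_le_exp_sum: "y ^ 4 \<le> 24 * (exp y + exp (- y))" for y :: real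
proof -
  have *: "y ^ 4 / 24 \<le> exp y" if "0 \<le> y" for y :: real
    using sum_le_suminf[OF summable_exp_generic[of y], of "{4}"] that
    by (simp add: exp_def fact_numeral field_simps)
  show ?thesis
  proof (cases "0 \<le> y")
    case True
    with *[of y] show ?thesis by (simp add: add_increasing2)
  next
    case False
    with *[of "- y"] show ?thesis by (simp add: add_increasing)
  qed
qed

lemma subgaussian_fourth_moment:
  assumes Z: "subgaussian M Z v" and "0 < v"
  shows "(\<integral>\<^sup>+\<omega>. ennreal (Z \<omega> ^ 4) \<partial>M) \<le> ennreal (96 * v\<^sup>2)"
proof -
  have [measurable]: "Z \<in> borel_measurable M" using Z by (simp add: subgaussian_def)
  \<comment> \<open>With this scale both exponential moments are at most exp (1 / 2), hence below 2;
    the constant is 96 = 24 * 2 * 2.\<close>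
  define t where "t = 1 / sqrt v"
  have t2: "t\<^sup>2 = 1 / v" and t4: "t ^ 4 = 1 / v\<^sup>2"
    using \<open>0 < v\<close> power_mult[of "sqrt v" 2 2] by (simp_all add: t_def power_divide)
  have "(\<integral>\<^sup>+\<omega>. ennreal (Z \<omega> ^ 4) \<partial>M)
      \<le> (\<integral>\<^sup>+\<omega>. ennreal (24 * v\<^sup>2) * (ennreal (exp (t * Z \<omega>)) + ennreal (exp (- t * Z \<omega>))) \<partial>M)"
  proof (rule nn_integral_mono)
    fix \<omega>
    have "Z \<omega> ^ 4 = v\<^sup>2 * (t * Z \<omega>) ^ 4"
      using \<open>0 < v\<close> by (simp add: power_mult_distrib t4)
    also have "\<dots> \<le> v\<^sup>2 * (24 * (exp (t * Z \<omega>) + exp (- (t * Z \<omega>))))"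
      by (intro mult_left_mono power4_le_exp_sum) simp
    finally have "Z \<omega> ^ 4 \<le> 24 * v\<^sup>2 * (exp (t * Z \<omega>) + exp (- t * Z \<omega>))"
      by (simp add: algebra_simps)
    then show "ennreal (Z \<omega> ^ 4) \<le> ennreal (24 * v\<^sup>2) * (ennreal (exp (t * Z \<omega>)) + ennreal (exp (- t * Z \<omega>)))"
      by (simp add: ennreal_mult'[symmetric] ennreal_plus[symmetric] ennreal_leI del: ennreal_plus)
  qed
  also have "\<dots> = ennreal (24 * v\<^sup>2) * ((\<integral>\<^sup>+\<omega>. ennreal (exp (t * Z \<omega>)) \<partial>M) + (\<integral>\<^sup>+\<omega>. ennreal (exp (- t * Z \<omega>)) \<partial>M))"
    by (subst nn_integral_cmult) (auto simp: nn_integral_add)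
  also have "\<dots> \<le> ennreal (24 * v\<^sup>2) * (ennreal (exp (t\<^sup>2 * v / 2)) + ennreal (exp ((- t)\<^sup>2 * v / 2)))"
    using Z unfolding subgaussian_def by (intro mult_left_mono add_mono zero_le) blast+
  also have "\<dots> = ennreal (48 * v\<^sup>2 * exp (1 / 2))"
    using \<open>0 < v\<close> by (simp add: t2 ennreal_mult'[symmetric] ennreal_plus[symmetric] del: ennreal_plus)
  also have "\<dots> \<le> ennreal (96 * v\<^sup>2)"
    using mult_left_mono[OF exp_half_le2, of "48 * v\<^sup>2"] by (intro ennreal_leI) simp
  finally show ?thesis .
qed

subsection \<open>Gaussian variables\<close>

context prob_space
begin

text \<open>The second disjunct is the degenerate case of variance 0.\<close>

definition gaussian :: "('a \<Rightarrow> real) \<Rightarrow> bool" where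
  "gaussian X \<longleftrightarrow> (\<exists>\<mu> \<sigma>. 0 < \<sigma> \<and> distributed M lborel X (normal_density \<mu> \<sigma>)) \<or> (\<exists>c. X = (\<lambda>_. c))"

lemma gaussian_indep_sum:
  assumes "finite I" and indep: "indep_vars (\<lambda>_. borel) X I"
    and ms: "\<And>i. i \<in> I \<Longrightarrow> 0 < \<sigma> i"
        "\<And>i. i \<in> I \<Longrightarrow> distributed M lborel (X i) (normal_density (\<mu> i) (\<sigma> i))"
  shows "gaussian (\<lambda>\<omega>. c + (\<Sum>i\<in>I. d i * X i \<omega>))"
proof -
  \<comment> \<open>Summands with coefficient 0 have no density and are dropped. If nothing remains,
    the sum is constant, which is the degenerate case of \<open>gaussian\<close>.\<close>
  define J where "J = {i\<in>I. d i \<noteq> 0}"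
  have eq: "(\<Sum>i\<in>I. d i * X i \<omega>) = (\<Sum>i\<in>J. d i * X i \<omega>)" for \<omega>
    using assms(1) by (intro sum.mono_neutral_right) (auto simp: J_def)
  show ?thesis
  proof (cases "J = {}")
    case True
    then show ?thesis by (auto simp: gaussian_def eq)
  next
    case False
    have "indep_vars (\<lambda>_. borel) (\<lambda>i \<omega>. d i * X i \<omega>) J"
      by (rule indep_vars_compose2[OF indep_vars_subset[OF indep]]) (auto simp: J_def)
    moreover have "distributed M lborel (\<lambda>\<omega>. d i * X i \<omega>) (normal_density (d i * \<mu> i) (\<bar>d i\<bar> * \<sigma> i))"
      if "i \<in> J" for i
      using that normal_density_affine[OF ms(2)[of i] ms(1)[of i], of "d i" 0] by (simp add: J_def)
    ultimately have sum: "distributed M lborel (\<lambda>\<omega>. \<Sum>i\<in>J. d i * X i \<omega>)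
        (normal_density (\<Sum>i\<in>J. d i * \<mu> i) (sqrt (\<Sum>i\<in>J. (\<bar>d i\<bar> * \<sigma> i)\<^sup>2)))"
      using assms(1) False ms(1) by (intro sum_indep_normal) (auto simp: J_def)
    have pos: "0 < sqrt (\<Sum>i\<in>J. (\<bar>d i\<bar> * \<sigma> i)\<^sup>2)"
    proof -
      have "0 < (\<bar>d i\<bar> * \<sigma> i)\<^sup>2" if "i \<in> J" for i
        using that ms(1)[of i] by (simp add: J_def)
      then show ?thesis
        using False assms(1) by (intro real_sqrt_gt_zero sum_pos) (auto simp: J_def)
    qed
    have "distributed M lborel (\<lambda>\<omega>. c + (\<Sum>i\<in>J. d i * X i \<omega>))
        (normal_density (c + (\<Sum>i\<in>J. d i * \<mu> i)) (sqrt (\<Sum>i\<in>J. (\<bar>d i\<bar> * \<sigma> i)\<^sup>2)))"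
      using normal_density_affine[OF sum pos, of 1 c] by simp
    with pos show ?thesis
      unfolding gaussian_def eq by blast
  qed
qed

lemma normal_mgf:
  assumes X: "distributed M lborel X (normal_density \<mu> \<sigma>)" and \<sigma>: "0 < \<sigma>"
  shows "(\<integral>\<^sup>+\<omega>. ennreal (exp (t * (X \<omega> - \<mu>))) \<partial>M) = ennreal (exp (t\<^sup>2 * \<sigma>\<^sup>2 / 2))"
proof -
  \<comment> \<open>Completing the square: the exponential tilt is again a normal density, with its
    mean moved by \<open>t * \<sigma>^2\<close>, and integrates to 1.\<close>
  have eq: "normal_density \<mu> \<sigma> x * exp (t * (x - \<mu>))
      = exp (t\<^sup>2 * \<sigma>\<^sup>2 / 2) * normal_density (\<mu> + t * \<sigma>\<^sup>2) \<sigma> x" for x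
  proof -
    have "- (x - \<mu>)\<^sup>2 / (2 * \<sigma>\<^sup>2) + t * (x - \<mu>) = t\<^sup>2 * \<sigma>\<^sup>2 / 2 + - (x - (\<mu> + t * \<sigma>\<^sup>2))\<^sup>2 / (2 * \<sigma>\<^sup>2)"
      using \<sigma> by (simp add: field_simps power2_eq_square)
    then show ?thesis
      unfolding normal_density_def by (simp add: mult_exp_exp mult.assoc mult.left_commute)
  qed
  have "(\<integral>\<^sup>+\<omega>. ennreal (exp (t * (X \<omega> - \<mu>))) \<partial>M)
      = (\<integral>\<^sup>+x. ennreal (normal_density \<mu> \<sigma> x) * ennreal (exp (t * (x - \<mu>))) \<partial>lborel)"
    by (rule distributed_nn_integral[OF X, symmetric]) simp
  also have "\<dots> = (\<integral>\<^sup>+x. ennreal (exp (t\<^sup>2 * \<sigma>\<^sup>2 / 2)) * ennreal (normal_density (\<mu> + t * \<sigma>\<^sup>2) \<sigma> x) \<partial>lborel)"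
    by (simp add: ennreal_mult'[symmetric] eq)
  also have "\<dots> = ennreal (exp (t\<^sup>2 * \<sigma>\<^sup>2 / 2)) * (\<integral>\<^sup>+x. ennreal (normal_density (\<mu> + t * \<sigma>\<^sup>2) \<sigma> x) \<partial>lborel)"
    by (rule nn_integral_cmult) simp
  also have "(\<integral>\<^sup>+x. ennreal (normal_density (\<mu> + t * \<sigma>\<^sup>2) \<sigma> x) \<partial>lborel) = 1"
    using \<sigma> by (subst nn_integral_eq_integral) auto
  finally show ?thesis by simp
qed

lemma gaussian_square_integrable:
  assumes "gaussian X"
  shows "integrable M (\<lambda>\<omega>. (X \<omega>)\<^sup>2)" "X \<in> borel_measurable M"
proof -
  from assms consider \<mu> \<sigma> where "0 < \<sigma>" "distributed M lborel X (normal_density \<mu> \<sigma>)" | c where "X = (\<lambda>_. c)"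
    unfolding gaussian_def by blast
  then have "integrable M (\<lambda>\<omega>. (X \<omega>)\<^sup>2) \<and> X \<in> borel_measurable M"
  proof cases
    case 1
    have X: "X \<in> borel_measurable M" using 1(2) by (simp add: distributed_def)
    have "integrable lborel (\<lambda>x. normal_density \<mu> \<sigma> x * (x - \<mu>)\<^sup>2)"
      using 1(1) by (rule integrable_normal_moment)
    then have "integrable M (\<lambda>\<omega>. (X \<omega> - \<mu>)\<^sup>2)"
      by (subst (asm) distributed_integrable[OF 1(2)]) auto
    moreover have "integrable M X"
      using integrable_normal_moment_nz_1[OF 1(1), of \<mu>]
      by (subst (asm) distributed_integrable[OF 1(2)]) auto
    ultimately have "integrable M (\<lambda>\<omega>. (X \<omega> - \<mu>)\<^sup>2 + 2 * \<mu> * X \<omega> - \<mu>\<^sup>2)"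
      by auto
    then show ?thesis
      using X by (simp add: power2_diff algebra_simps)
  qed auto
  then show "integrable M (\<lambda>\<omega>. (X \<omega>)\<^sup>2)" "X \<in> borel_measurable M" by blast+
qed

lemma gaussian_subgaussian:
  assumes "gaussian X"
  shows "subgaussian M (\<lambda>\<omega>. X \<omega> - expectation X) (variance X)"
proof -
  from assms consider \<mu> \<sigma> where "0 < \<sigma>" "distributed M lborel X (normal_density \<mu> \<sigma>)" | c where "X = (\<lambda>_. c)"
    by (auto simp: gaussian_def)
  then show ?thesis
  proof cases
    case 1
    then show ?thesis
      using gaussian_square_integrable(2)[OF assms]
      by (simp add: subgaussian_def normal_distributed_variance[OF 1, unfolded normal_distributed_expectation[OF 1]]
          normal_distributed_expectation[OF 1] normal_mgf[OF 1(2,1)])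
  qed (simp add: subgaussian_def prob_space emeasure_space_1)
qed

section \<open>Second moments and mean square limits of Gaussian variables\<close>

lemma square_expectation_le:
  fixes Y :: "'a \<Rightarrow> real"
  assumes "integrable M Y" "integrable M (\<lambda>\<omega>. (Y \<omega>)\<^sup>2)"
  shows "(expectation Y)\<^sup>2 \<le> expectation (\<lambda>\<omega>. (Y \<omega>)\<^sup>2)"
  using variance_eq[OF assms] variance_positive[of Y] by simp

text \<open>The decomposition of a quadratic risk into variance and squared bias.\<close>

lemma expectation_square_shift:
  fixes Y :: "'a \<Rightarrow> real"
  assumes "integrable M Y" "integrable M (\<lambda>\<omega>. (Y \<omega>)\<^sup>2)"
  shows "expectation (\<lambda>\<omega>. (Y \<omega> - a)\<^sup>2) = variance Y + (expectation Y - a)\<^sup>2"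
proof -
  have "expectation (\<lambda>\<omega>. (Y \<omega> - a)\<^sup>2) = expectation (\<lambda>\<omega>. (Y \<omega>)\<^sup>2) - 2 * a * expectation Y + a\<^sup>2"
    using assms by (simp add: power2_diff prob_space algebra_simps)
  also have "\<dots> = variance Y + (expectation Y - a)\<^sup>2"
    using variance_eq[OF assms] power2_diff[of "expectation Y" a] by simp
  finally show ?thesis .
qed

text \<open>Means converge, and along a subsequence \<open>S\<close> converges almost surely, so
  Fatou carries the bound on the Laplace transforms over to \<open>X\<close>. Normality of the limit
  is never established: of the variances only an asymptotic upper bound is required.\<close>

lemma subgaussian_L2_limit:
  fixes S :: "nat \<Rightarrow> 'a \<Rightarrow> real"
  assumes S: "\<And>m. gaussian (S m)"
    and X[measurable]: "X \<in> borel_measurable M"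
    and lim: "(\<lambda>m. \<integral>\<^sup>+\<omega>. ennreal ((S m \<omega> - X \<omega>)\<^sup>2) \<partial>M) \<longlonglongrightarrow> 0"
  shows "integrable M (\<lambda>\<omega>. (X \<omega>)\<^sup>2)"
    and "subgaussian M (\<lambda>\<omega>. X \<omega> - expectation X) (variance X)"
proof -
  note S_sq = gaussian_square_integrable(1)[OF S]
  have S_meas[measurable]: "S m \<in> borel_measurable M" for m
    by (rule gaussian_square_integrable(2)[OF S])
  have "eventually (\<lambda>m. (\<integral>\<^sup>+\<omega>. ennreal ((S m \<omega> - X \<omega>)\<^sup>2) \<partial>M) < 1) sequentially"
    using order_tendstoD(2)[OF lim] by simp
  then obtain m0 where "(\<integral>\<^sup>+\<omega>. ennreal ((S m0 \<omega> - X \<omega>)\<^sup>2) \<partial>M) < 1"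
    by (auto simp: eventually_sequentially)
  then have "(\<integral>\<^sup>+\<omega>. ennreal ((S m0 \<omega> - X \<omega>)\<^sup>2) \<partial>M) < \<infinity>"
    by (rule less_trans) simp
  then have "integrable M (\<lambda>\<omega>. (S m0 \<omega> - X \<omega>)\<^sup>2)"
    by (intro integrableI_nonneg) auto
  then have "integrable M (\<lambda>\<omega>. 2 * (S m0 \<omega>)\<^sup>2 + 2 * (S m0 \<omega> - X \<omega>)\<^sup>2)"
    using S_sq by auto
  then show X_sq: "integrable M (\<lambda>\<omega>. (X \<omega>)\<^sup>2)"
  proof (rule Bochner_Integration.integrable_bound)
    have "(X \<omega>)\<^sup>2 \<le> 2 * (S m0 \<omega>)\<^sup>2 + 2 * (S m0 \<omega> - X \<omega>)\<^sup>2" for \<omega>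
      using zero_le_power2[of "2 * S m0 \<omega> - X \<omega>"] by (simp add: power2_eq_square algebra_simps)
    then show "AE \<omega> in M. norm ((X \<omega>)\<^sup>2) \<le> norm (2 * (S m0 \<omega>)\<^sup>2 + 2 * (S m0 \<omega> - X \<omega>)\<^sup>2)"
      by simp
  qed simp
  have S_int: "integrable M (S m)" and X_int: "integrable M X" for m
    using square_integrable_imp_integrable[OF S_meas S_sq] square_integrable_imp_integrable[OF X X_sq] by auto
  have SX_sq: "integrable M (\<lambda>\<omega>. (S m \<omega> - X \<omega>)\<^sup>2)" for m
  proof (rule Bochner_Integration.integrable_bound)
    show "integrable M (\<lambda>\<omega>. 2 * (S m \<omega>)\<^sup>2 + 2 * (X \<omega>)\<^sup>2)"
      using S_sq X_sq by auto
    have "(S m \<omega> - X \<omega>)\<^sup>2 \<le> 2 * (S m \<omega>)\<^sup>2 + 2 * (X \<omega>)\<^sup>2" for \<omega>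
      using zero_le_power2[of "S m \<omega> + X \<omega>"] by (simp add: power2_eq_square algebra_simps)
    then show "AE \<omega> in M. norm ((S m \<omega> - X \<omega>)\<^sup>2) \<le> norm (2 * (S m \<omega>)\<^sup>2 + 2 * (X \<omega>)\<^sup>2)"
      by simp
  qed simp
  define e where "e m = expectation (\<lambda>\<omega>. (S m \<omega> - X \<omega>)\<^sup>2)" for m
  have "(\<integral>\<^sup>+\<omega>. ennreal ((S m \<omega> - X \<omega>)\<^sup>2) \<partial>M) = ennreal (e m)" for m
    unfolding e_def by (rule nn_integral_eq_integral[OF SX_sq]) simp
  with lim have "(\<lambda>m. ennreal (e m)) \<longlonglongrightarrow> ennreal 0" by simp
  then have e_lim: "e \<longlonglongrightarrow> 0"
    by (rule tendsto_ennrealD) (auto simp: e_def)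
  have mean_lim: "(\<lambda>m. expectation (S m)) \<longlonglongrightarrow> expectation X"
  proof -
    have "(\<lambda>m. (expectation (S m) - expectation X)\<^sup>2) \<longlonglongrightarrow> 0"
    proof (rule tendsto_sandwich[OF _ _ tendsto_const e_lim])
      show "\<forall>\<^sub>F m in sequentially. (expectation (S m) - expectation X)\<^sup>2 \<le> e m"
        using square_expectation_le[OF _ SX_sq] S_int X_int by (simp add: e_def)
    qed simp
    then show ?thesis
      by (simp add: LIM_zero_iff)
  qed
  have "\<exists>r. strict_mono r \<and> (AE \<omega> in M. (\<lambda>m. (S (r m) \<omega> - X \<omega>)\<^sup>2) \<longlonglongrightarrow> 0)"
    using e_lim by (intro tendsto_L1_AE_subseq[OF SX_sq]) (simp add: e_def[abs_def])
  then obtain r where r: "strict_mono r" "AE \<omega> in M. (\<lambda>m. (S (r m) \<omega> - X \<omega>)\<^sup>2) \<longlonglongrightarrow> 0"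
    by blast
  \<comment> \<open>Young's inequality with a free weight \<delta>. A fixed weight would lose a
    constant factor in the variance; taking the limit in \<open>m\<close> first and letting \<delta>
    tend to 0 afterwards keeps \<open>variance X\<close> itself.\<close>
  have var_le: "variance (S m) \<le> (1 + \<delta>) * variance X + (1 + 1 / \<delta>) * e m" if "0 < \<delta>" for m \<delta>
  proof -
    have young: "(x - a)\<^sup>2 \<le> (1 + \<delta>) * (y - a)\<^sup>2 + (1 + 1 / \<delta>) * (x - y)\<^sup>2" for x y a :: real
    proof -
      have "0 \<le> (\<delta> * (y - a) - (x - y))\<^sup>2 / \<delta>" using that by simp
      also have "\<dots> = (1 + \<delta>) * (y - a)\<^sup>2 + (1 + 1 / \<delta>) * (x - y)\<^sup>2 - (x - a)\<^sup>2"
        using that by (simp add: field_simps power2_eq_square)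
      finally show ?thesis by simp
    qed
    have X_var: "integrable M (\<lambda>\<omega>. (X \<omega> - expectation X)\<^sup>2)"
      and S_var: "integrable M (\<lambda>\<omega>. (S m \<omega> - expectation X)\<^sup>2)"
      using S_sq X_sq S_int X_int by (auto simp: power2_diff)
    have "variance (S m) \<le> expectation (\<lambda>\<omega>. (S m \<omega> - expectation X)\<^sup>2)"
      using expectation_square_shift[OF S_int S_sq, of m "expectation X"]
        zero_le_power2[of "expectation (S m) - expectation X"] by linarith
    also have "\<dots> \<le> expectation (\<lambda>\<omega>. (1 + \<delta>) * (X \<omega> - expectation X)\<^sup>2 + (1 + 1 / \<delta>) * (S m \<omega> - X \<omega>)\<^sup>2)"
      using X_var S_var SX_sq young by (intro integral_mono) auto
    also have "\<dots> = (1 + \<delta>) * variance X + (1 + 1 / \<delta>) * e m"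
      using X_var SX_sq by (simp add: e_def)
    finally show ?thesis .
  qed
  have "(\<integral>\<^sup>+\<omega>. ennreal (exp (t * (X \<omega> - expectation X))) \<partial>M) \<le> ennreal (exp (t\<^sup>2 * ((1 + \<delta>) * variance X) / 2))"
    if \<delta>: "0 < \<delta>" for t \<delta>
  proof -
    have "AE \<omega> in M. (\<lambda>m. ennreal (exp (t * (S (r m) \<omega> - expectation (S (r m))))))
        \<longlonglongrightarrow> ennreal (exp (t * (X \<omega> - expectation X)))"
      using r(2)
    proof eventually_elim
      case (elim \<omega>)
      then have "(\<lambda>m. S (r m) \<omega>) \<longlonglongrightarrow> X \<omega>"
        by (simp add: LIM_zero_iff)
      then show ?case
        using LIMSEQ_subseq_LIMSEQ[OF mean_lim r(1)] by (auto intro!: tendsto_intros simp: o_def)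
    qed
    then have "AE \<omega> in M. ennreal (exp (t * (X \<omega> - expectation X)))
        = liminf (\<lambda>m. ennreal (exp (t * (S (r m) \<omega> - expectation (S (r m))))))"
      by eventually_elim (rule lim_imp_Liminf[OF sequentially_bot, symmetric])
    then have "(\<integral>\<^sup>+\<omega>. ennreal (exp (t * (X \<omega> - expectation X))) \<partial>M)
        = (\<integral>\<^sup>+\<omega>. liminf (\<lambda>m. ennreal (exp (t * (S (r m) \<omega> - expectation (S (r m)))))) \<partial>M)"
      by (rule nn_integral_cong_AE)
    also have "\<dots> \<le> liminf (\<lambda>m. \<integral>\<^sup>+\<omega>. ennreal (exp (t * (S (r m) \<omega> - expectation (S (r m))))) \<partial>M)"
      by (rule nn_integral_liminf) simp
    also have "\<dots> \<le> liminf (\<lambda>m. ennreal (exp (t\<^sup>2 * ((1 + \<delta>) * variance X + (1 + 1 / \<delta>) * e (r m)) / 2)))"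
    proof (intro Liminf_mono always_eventually allI)
      fix m
      show "(\<integral>\<^sup>+\<omega>. ennreal (exp (t * (S (r m) \<omega> - expectation (S (r m))))) \<partial>M)
          \<le> ennreal (exp (t\<^sup>2 * ((1 + \<delta>) * variance X + (1 + 1 / \<delta>) * e (r m)) / 2))"
        using subgaussian_mono[OF gaussian_subgaussian[OF S] var_le[OF \<delta>]]
        by (simp add: subgaussian_def)
    qed
    also have "\<dots> = ennreal (exp (t\<^sup>2 * ((1 + \<delta>) * variance X + (1 + 1 / \<delta>) * 0) / 2))"
      using LIMSEQ_subseq_LIMSEQ[OF e_lim r(1)]
      unfolding o_def by (intro lim_imp_Liminf sequentially_bot tendsto_intros) simp_all
    finally show ?thesis by simp
  qed
  note bound = this
  have "(\<integral>\<^sup>+\<omega>. ennreal (exp (t * (X \<omega> - expectation X))) \<partial>M) \<le> ennreal (exp (t\<^sup>2 * variance X / 2))" for t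
  proof (rule tendsto_lowerbound)
    have "((\<lambda>\<delta>. ennreal (exp (t\<^sup>2 * ((1 + \<delta>) * variance X) / 2))) \<longlongrightarrow> ennreal (exp (t\<^sup>2 * ((1 + 0) * variance X) / 2))) (at_right 0)"
      by (intro tendsto_intros) simp
    then show "((\<lambda>\<delta>. ennreal (exp (t\<^sup>2 * ((1 + \<delta>) * variance X) / 2))) \<longlongrightarrow> ennreal (exp (t\<^sup>2 * variance X / 2))) (at_right 0)"
      by simp
    show "\<forall>\<^sub>F \<delta> in at_right 0. (\<integral>\<^sup>+\<omega>. ennreal (exp (t * (X \<omega> - expectation X))) \<partial>M)
        \<le> ennreal (exp (t\<^sup>2 * ((1 + \<delta>) * variance X) / 2))"
      using eventually_at_right_less by (rule eventually_mono) (rule bound)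
  qed simp
  then show "subgaussian M (\<lambda>\<omega>. X \<omega> - expectation X) (variance X)"
    by (simp add: subgaussian_def)
qed

end

section \<open>Step integrals of the observed path and linear estimators\<close>

lemma step_integral_increments:
  assumes ts: "sorted ts" "distinct ts"
    and \<phi>: "\<And>a b c. (a, b, c) \<in> set \<phi> \<Longrightarrow> a \<in> set ts \<and> b \<in> set ts \<and> a \<le> b"
  shows "\<exists>\<kappa> d. \<forall>\<omega>. step_integral \<phi> (observation W n f) \<omega>
    = \<kappa> + (\<Sum>i<length ts - 1. d i * (W (ts ! Suc i) \<omega> - W (ts ! i) \<omega>))"
  using \<phi>
proof (induction \<phi>)
  case Nil
  have "step_integral [] (observation W n f) \<omega>
    = 0 + (\<Sum>i<length ts - 1. 0 * (W (ts ! Suc i) \<omega> - W (ts ! i) \<omega>))" for \<omega>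
    by (simp add: step_integral_def)
  then show ?case by (intro exI allI)
next
  case (Cons s \<phi>)
  obtain a b c where s: "s = (a, b, c)" by (cases s)
  have "\<exists>\<kappa> d. \<forall>\<omega>. step_integral \<phi> (observation W n f) \<omega>
      = \<kappa> + (\<Sum>i<length ts - 1. d i * (W (ts ! Suc i) \<omega> - W (ts ! i) \<omega>))"
    using Cons.prems by (intro Cons.IH) auto
  then obtain \<kappa> d where IH: "\<And>\<omega>. step_integral \<phi> (observation W n f) \<omega>
      = \<kappa> + (\<Sum>i<length ts - 1. d i * (W (ts ! Suc i) \<omega> - W (ts ! i) \<omega>))"
    by blast
  have ab: "a \<in> set ts" "b \<in> set ts" "a \<le> b" using Cons.prems s by auto
  then obtain p q' where p: "p < length ts" "ts ! p = a" and q': "q' < length ts" "ts ! q' = b"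
    by (meson in_set_conv_nth)
  \<comment> \<open>If \<open>q' < p\<close>, sortedness forces \<open>a = b\<close>, and then
    \<open>p\<close> is an index of \<open>b\<close> as well; the run \<open>{p..<q}\<close> is
    empty in that case.\<close>
  define q where "q = max p q'"
  have q: "q < length ts" "ts ! q = b" "p \<le> q"
    using p q' ab(3) sorted_nth_mono[OF ts(1), of q' p] by (auto simp: q_def max_def)
  \<comment> \<open>The interval is the run of grid cells \<open>p\<close> to \<open>q - 1\<close>,
    over which the noise increments telescope. Intervals may overlap, so the new coefficient is
    added to the old ones; the drift is deterministic and goes into the constant.\<close>
  define d' where "d' i = d i + (if i \<in> {p..<q} then c / sqrt (real n) else 0)" for i
  define \<kappa>' where "\<kappa>' = \<kappa> + c * (drift f b - drift f a)"
  have "step_integral (s # \<phi>) (observation W n f) \<omega>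
      = \<kappa>' + (\<Sum>i<length ts - 1. d' i * (W (ts ! Suc i) \<omega> - W (ts ! i) \<omega>))" for \<omega>
  proof -
    have "(\<Sum>i<length ts - 1. (if i \<in> {p..<q} then c / sqrt (real n) else 0) * (W (ts ! Suc i) \<omega> - W (ts ! i) \<omega>))
        = (\<Sum>i\<in>{p..<q}. c / sqrt (real n) * (W (ts ! Suc i) \<omega> - W (ts ! i) \<omega>))"
      using q(1) by (intro sum.mono_neutral_cong_right) auto
    also have "\<dots> = c / sqrt (real n) * (\<Sum>i\<in>{p..<q}. W (ts ! Suc i) \<omega> - W (ts ! i) \<omega>)"
      by (simp only: sum_distrib_left)
    also have "(\<Sum>i\<in>{p..<q}. W (ts ! Suc i) \<omega> - W (ts ! i) \<omega>) = W b \<omega> - W a \<omega>"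
      using sum_Suc_diff'[OF q(3), of "\<lambda>i. W (ts ! i) \<omega>"] p(2) q(2) by simp
    finally have tele: "(\<Sum>i<length ts - 1. (if i \<in> {p..<q} then c / sqrt (real n) else 0) * (W (ts ! Suc i) \<omega> - W (ts ! i) \<omega>))
        = c / sqrt (real n) * (W b \<omega> - W a \<omega>)" .
    have "step_integral (s # \<phi>) (observation W n f) \<omega>
        = c * (drift f b - drift f a) + c / sqrt (real n) * (W b \<omega> - W a \<omega>) + step_integral \<phi> (observation W n f) \<omega>"
      by (simp add: s step_integral_def observation_def diff_divide_distrib algebra_simps)
    then show ?thesis
      by (simp only: IH d'_def distrib_right sum.distrib tele \<kappa>'_def)
  qed
  then show ?case by blast
qed

text \<open>All endpoints are collected into one sorted grid without repetitions. Its cells have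
  positive length, so their increments are independent with genuine normal densities, which is not
  true of the increments over the original intervals.\<close>

lemma step_integral_gaussian:
  assumes W: "standard_brownian_motion M W" and \<phi>: "step_on_interval \<phi>"
  shows "prob_space.gaussian M (step_integral \<phi> (observation W n f))"
proof -
  interpret prob_space M using W by (simp add: standard_brownian_motion_def)
  define P where "P = (\<Union>(a, b, c)\<in>set \<phi>. {a, b})"
  have P: "finite P" by (auto simp: P_def)
  define ts where "ts = sorted_list_of_set P"
  have ts: "sorted ts" "distinct ts" "set ts = P" "sorted_wrt (<) ts"
    using P by (auto simp: ts_def)
  have P_time: "P \<subseteq> time_interval"
    using \<phi> by (fastforce simp: P_def step_on_interval_def)
  have ends: "a \<in> set ts \<and> b \<in> set ts \<and> a \<le> b" if "(a, b, c) \<in> set \<phi>" for a b c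
    using that \<phi> by (fastforce simp: ts(3) P_def step_on_interval_def)
  have "\<exists>\<kappa> d. \<forall>\<omega>. step_integral \<phi> (observation W n f) \<omega>
      = \<kappa> + (\<Sum>i<length ts - 1. d i * (W (ts ! Suc i) \<omega> - W (ts ! i) \<omega>))"
    by (rule step_integral_increments[OF ts(1,2)]) (erule ends)
  then obtain \<kappa> d where eq: "\<forall>\<omega>. step_integral \<phi> (observation W n f) \<omega>
      = \<kappa> + (\<Sum>i<length ts - 1. d i * (W (ts ! Suc i) \<omega> - W (ts ! i) \<omega>))"
    by (elim exE)
  have "gaussian (\<lambda>\<omega>. \<kappa> + (\<Sum>i<length ts - 1. d i * (W (ts ! Suc i) \<omega> - W (ts ! i) \<omega>)))"
  proof (rule gaussian_indep_sum)
    show "indep_vars (\<lambda>_. borel) (\<lambda>i \<omega>. W (ts ! Suc i) \<omega> - W (ts ! i) \<omega>) {..<length ts - 1}"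
      using W ts P_time by (simp add: standard_brownian_motion_def)
    fix i assume "i \<in> {..<length ts - 1}"
    then have i: "i < length ts" "Suc i < length ts" by auto
    then have "ts ! i < ts ! Suc i" "ts ! i \<in> time_interval" "ts ! Suc i \<in> time_interval"
      using sorted_wrt_nth_less[OF ts(4), of i "Suc i"] P_time nth_mem[of i ts] nth_mem[of "Suc i" ts]
      unfolding ts(3) by auto
    then show "distributed M lborel (\<lambda>\<omega>. W (ts ! Suc i) \<omega> - W (ts ! i) \<omega>)
        (normal_density 0 (sqrt (ts ! Suc i - ts ! i)))" "0 < sqrt (ts ! Suc i - ts ! i)"
      using W by (auto simp: standard_brownian_motion_def)
  qed simp
  moreover have "step_integral \<phi> (observation W n f)
      = (\<lambda>\<omega>. \<kappa> + (\<Sum>i<length ts - 1. d i * (W (ts ! Suc i) \<omega> - W (ts ! i) \<omega>)))"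
    by (rule ext) (rule eq[rule_format])
  ultimately show ?thesis by simp
qed

text \<open>The limit lemma applies to \<open>X f\<close> minus the constant \<open>a\<close>;
  adding \<open>a\<close> back moves the mean but leaves the centred variable unchanged.\<close>

lemma linear_estimator_subgaussian:
  assumes W: "standard_brownian_motion M W" and X: "linear_estimator M W n X"
  shows "X f \<in> borel_measurable M" "integrable M (\<lambda>\<omega>. (X f \<omega>)\<^sup>2)"
    and "subgaussian M (\<lambda>\<omega>. X f \<omega> - prob_space.expectation M (X f)) (prob_space.variance M (X f))"
proof -
  interpret prob_space M using W by (simp add: standard_brownian_motion_def)
  obtain a h where "has_wiener_integral M (observation W n f) h (\<lambda>\<omega>. X f \<omega> - a)"
    using X unfolding linear_estimator_def by blast
  then have meas: "(\<lambda>\<omega>. X f \<omega> - a) \<in> borel_measurable M"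
    and "\<exists>\<phi>. (\<forall>m. step_on_interval (\<phi> m)) \<and> (\<lambda>m. step_L2 (\<phi> m)) \<longlonglongrightarrow> h \<and>
      (\<lambda>m. \<integral>\<^sup>+\<omega>. ennreal ((step_integral (\<phi> m) (observation W n f) \<omega> - (X f \<omega> - a))\<^sup>2) \<partial>M) \<longlonglongrightarrow> 0"
    unfolding has_wiener_integral_def by auto
  then obtain \<phi> where \<phi>: "\<And>m. step_on_interval (\<phi> m)"
    and lim: "(\<lambda>m. \<integral>\<^sup>+\<omega>. ennreal ((step_integral (\<phi> m) (observation W n f) \<omega> - (X f \<omega> - a))\<^sup>2) \<partial>M) \<longlonglongrightarrow> 0"
    by auto
  have "(\<lambda>\<omega>. (X f \<omega> - a) + a) \<in> borel_measurable M"
    using meas by (rule borel_measurable_add) simp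
  then show X_meas: "X f \<in> borel_measurable M" by simp
  note limit = subgaussian_L2_limit[OF step_integral_gaussian[OF W \<phi>] meas lim]
  have int: "integrable M (\<lambda>\<omega>. X f \<omega> - a)"
    by (rule square_integrable_imp_integrable[OF meas limit(1)])
  have "integrable M (\<lambda>\<omega>. (X f \<omega> - a)\<^sup>2 + 2 * a * (X f \<omega> - a) + a\<^sup>2)"
    using limit(1) int by (intro Bochner_Integration.integrable_add integrable_mult_right) auto
  moreover have "(x - a)\<^sup>2 + 2 * a * (x - a) + a\<^sup>2 = x\<^sup>2" for x :: real
    by (simp add: power2_eq_square algebra_simps)
  ultimately show "integrable M (\<lambda>\<omega>. (X f \<omega>)\<^sup>2)" by simp
  have "integrable M (X f)"
    using Bochner_Integration.integrable_add[OF int integrable_const[of a]] by simp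
  then have "expectation (\<lambda>\<omega>. X f \<omega> - a) = expectation (X f) - a"
    by (simp add: prob_space)
  with limit(2) show "subgaussian M (\<lambda>\<omega>. X f \<omega> - expectation (X f)) (variance (X f))"
    by simp
qed

section \<open>Moduli and rates\<close>

locale nested_spaces =
  fixes T :: "L2 \<Rightarrow> real" and F :: "nat \<Rightarrow> L2 set" and k :: nat and D :: "L2 set"
  assumes k: "1 \<le> k"
    and convex: "\<And>i. i \<in> {1..k} \<Longrightarrow> convex (F i)"
    and nested: "\<And>i. i \<in> {1..<k} \<Longrightarrow> F i \<subseteq> F (Suc i)"
    and linear: "linear_functional_on D T" "F k \<subseteq> D"
    and nonempty: "F 1 \<noteq> {}"
    and finite_modulus: "\<And>\<epsilon>. \<epsilon> > 0 \<Longrightarrow> bdd_above (modulus_diffs T \<epsilon> (F k) (F k))"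
    and positive_modulus: "\<And>\<epsilon>. \<epsilon> > 0 \<Longrightarrow> omega T \<epsilon> (F 1) (F 1) > 0"
begin

lemma F_mono:
  assumes "1 \<le> i" "i \<le> j" "j \<le> k"
  shows "F i \<subseteq> F j"
  using assms(2,3)
proof (induction j rule: dec_induct)
  case (step m)
  then show ?case using nested[of m] assms(1) by fastforce
qed simp

text \<open>\<open>T\<close> is linear only on the subspace \<open>D\<close>, so the point of the
  segment is rewritten as a combination of \<open>f\<close> and \<open>g\<close>, both in
  \<open>D\<close>, before \<open>T\<close> is applied.\<close>

lemma T_segment:
  assumes "f \<in> F k" "g \<in> F k"
  shows "T (f + c *\<^sub>R (g - f)) - T f = c * (T g - T f)"
proof -
  have D: "f \<in> D" "g \<in> D" and sub: "subspace D" using assms linear by (auto simp: linear_functional_on_def)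
  have add: "T (u + v) = T u + T v" if "u \<in> D" "v \<in> D" for u v
    using linear(1) that by (simp add: linear_functional_on_def)
  have scale: "T (a *\<^sub>R u) = a * T u" if "u \<in> D" for a u
    using linear(1) that by (simp add: linear_functional_on_def)
  have "f + c *\<^sub>R (g - f) = (1 - c) *\<^sub>R f + c *\<^sub>R g" by (simp add: algebra_simps)
  then have "T (f + c *\<^sub>R (g - f)) = (1 - c) * T f + c * T g"
    using D sub by (simp add: add scale subspace_scale)
  then show ?thesis by (simp add: algebra_simps)
qed

text \<open>Both spaces lie in \<open>F k\<close>, where \<open>f\<close> and \<open>g\<close> may
  be exchanged; a one-sided bound there is therefore two-sided.\<close>

lemma bdd_abs_modulus_diffs:
  assumes "0 < \<epsilon>" "i \<in> {1..k}" "j \<in> {1..k}"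
  shows "bdd_above (abs ` modulus_diffs T \<epsilon> (F i) (F j))"
proof -
  obtain B where B: "\<And>x. x \<in> modulus_diffs T \<epsilon> (F k) (F k) \<Longrightarrow> x \<le> B"
    using finite_modulus[OF assms(1)] by (auto simp: bdd_above_def)
  have "\<bar>x\<bar> \<le> B" if x: "x \<in> modulus_diffs T \<epsilon> (F i) (F j)" for x
  proof -
    obtain f g where fg: "x = T g - T f" "norm (g - f) \<le> \<epsilon>" "f \<in> F k" "g \<in> F k"
      using x F_mono[of i k] F_mono[of j k] assms(2,3) unfolding modulus_diffs_def by auto
    then have "T g - T f \<in> modulus_diffs T \<epsilon> (F k) (F k)" "T f - T g \<in> modulus_diffs T \<epsilon> (F k) (F k)"
      using norm_minus_commute[of g f] unfolding modulus_diffs_def by fastforce+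
    then have "T g - T f \<le> B" "T f - T g \<le> B" by (auto intro: B)
    then show ?thesis using fg(1) by linarith
  qed
  then show ?thesis by (auto simp: bdd_above_def)
qed

lemma bdd_modulus_diffs:
  assumes "0 < \<epsilon>" "i \<in> {1..k}" "j \<in> {1..k}"
  shows "bdd_above (modulus_diffs T \<epsilon> (F i) (F j))"
proof -
  obtain B where "\<And>x. x \<in> modulus_diffs T \<epsilon> (F i) (F j) \<Longrightarrow> \<bar>x\<bar> \<le> B"
    using bdd_abs_modulus_diffs[OF assms] by (auto simp: bdd_above_def)
  then show ?thesis unfolding bdd_above_def by (meson abs_le_D1)
qed

text \<open>A point of \<open>F 1\<close> belongs to both spaces. The sets of differences are thus
  nonempty, as is necessary for bounding their real suprema.\<close>

lemma modulus_diffs_zero: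
  assumes "0 \<le> \<epsilon>" "i \<in> {1..k}" "j \<in> {1..k}"
  shows "0 \<in> modulus_diffs T \<epsilon> (F i) (F j)"
proof -
  obtain f where "f \<in> F 1" using nonempty by blast
  then have "f \<in> F i" "f \<in> F j" using F_mono[of 1 i] F_mono[of 1 j] assms by auto
  then show ?thesis using assms(1) unfolding modulus_diffs_def by force
qed

lemma diff_le_omega:
  assumes "0 < \<epsilon>" "i \<in> {1..k}" "j \<in> {1..k}" "f \<in> F i" "g \<in> F j" "norm (g - f) \<le> \<epsilon>"
  shows "T g - T f \<le> omega T \<epsilon> (F i) (F j)"
  unfolding omega_def using assms
  by (intro cSup_upper bdd_modulus_diffs) (auto simp: modulus_diffs_def)

lemma omega_leI:
  assumes "0 \<le> \<epsilon>" "i \<in> {1..k}" "j \<in> {1..k}"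
    and "\<And>f g. f \<in> F i \<Longrightarrow> g \<in> F j \<Longrightarrow> norm (g - f) \<le> \<epsilon> \<Longrightarrow> T g - T f \<le> c"
  shows "omega T \<epsilon> (F i) (F j) \<le> c"
  unfolding omega_def using modulus_diffs_zero[OF assms(1-3)] assms(4)
  by (intro cSup_least) (auto simp: modulus_diffs_def)

lemma omega_mono:
  assumes "0 < \<epsilon>" "\<epsilon> \<le> \<epsilon>'" "1 \<le> i" "i \<le> i'" "i' \<le> k" "1 \<le> j" "j \<le> j'" "j' \<le> k"
  shows "omega T \<epsilon> (F i) (F j) \<le> omega T \<epsilon>' (F i') (F j')"
  using assms F_mono[of i i'] F_mono[of j j'] by (intro omega_leI diff_le_omega) auto

lemma omega_pos:
  assumes "0 < \<epsilon>" "i \<in> {1..k}" "j \<in> {1..k}"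
  shows "0 < omega T \<epsilon> (F i) (F j)"
  using positive_modulus[OF assms(1)] omega_mono[of \<epsilon> \<epsilon> 1 i 1 j] assms by simp

lemma abs_diff_le_omega_plus:
  assumes "0 < \<epsilon>" "i \<in> {1..k}" "j \<in> {1..k}" "f \<in> F i" "g \<in> F j" "norm (g - f) \<le> \<epsilon>"
  shows "\<bar>T g - T f\<bar> \<le> omega_plus T \<epsilon> (F i) (F j)"
  unfolding omega_plus_def using assms
  by (intro cSup_upper bdd_abs_modulus_diffs imageI) (auto simp: modulus_diffs_def)

lemma omega_plus_leI:
  assumes "0 \<le> \<epsilon>" "i \<in> {1..k}" "j \<in> {1..k}"
    and "\<And>f g. f \<in> F i \<Longrightarrow> g \<in> F j \<Longrightarrow> norm (g - f) \<le> \<epsilon> \<Longrightarrow> \<bar>T g - T f\<bar> \<le> c"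
  shows "omega_plus T \<epsilon> (F i) (F j) \<le> c"
  unfolding omega_plus_def using modulus_diffs_zero[OF assms(1-3)] assms(4)
  by (intro cSup_least) (auto simp: modulus_diffs_def)

lemma omega_plus_mono:
  assumes "0 < \<epsilon>" "\<epsilon> \<le> \<epsilon>'" "1 \<le> i" "i \<le> i'" "i' \<le> k" "1 \<le> j" "j \<le> j'" "j' \<le> k"
  shows "omega_plus T \<epsilon> (F i) (F j) \<le> omega_plus T \<epsilon>' (F i') (F j')"
  using assms F_mono[of i i'] F_mono[of j j'] by (intro omega_plus_leI abs_diff_le_omega_plus) auto

lemma omega_le_omega_plus:
  assumes "0 < \<epsilon>" "i \<in> {1..k}" "j \<in> {1..k}"
  shows "omega T \<epsilon> (F i) (F j) \<le> omega_plus T \<epsilon> (F i) (F j)"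
  using assms abs_diff_le_omega_plus by (intro omega_leI) (fastforce dest: abs_le_D1)+

lemma omega_plus_pos:
  assumes "0 < \<epsilon>" "i \<in> {1..k}" "j \<in> {1..k}"
  shows "0 < omega_plus T \<epsilon> (F i) (F j)"
  using omega_pos[OF assms] omega_le_omega_plus[OF assms] by simp

lemma omega_plus_commute:
  assumes "0 < \<epsilon>" "i \<in> {1..k}" "j \<in> {1..k}"
  shows "omega_plus T \<epsilon> (F i) (F j) = omega_plus T \<epsilon> (F j) (F i)"
proof -
  have "omega_plus T \<epsilon> (F i) (F j) \<le> omega_plus T \<epsilon> (F j) (F i)" if "i \<in> {1..k}" "j \<in> {1..k}" for i j
  proof (rule omega_plus_leI)
    fix f g assume "f \<in> F i" "g \<in> F j" "norm (g - f) \<le> \<epsilon>"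
    then have "\<bar>T f - T g\<bar> \<le> omega_plus T \<epsilon> (F j) (F i)"
      using that assms(1) by (intro abs_diff_le_omega_plus) (auto simp: norm_minus_commute)
    then show "\<bar>T g - T f\<bar> \<le> omega_plus T \<epsilon> (F j) (F i)" by (simp add: abs_minus_commute)
  qed (use that assms(1) in auto)
  from this[of i j] this[of j i] show ?thesis using assms by auto
qed

text \<open>One of the two spaces contains the other, so a difference \<open>g - f\<close> can be shortened inside
  the larger space while the endpoint in the smaller one is kept.\<close>

lemma omega_scale:
  assumes \<epsilon>: "0 < \<epsilon>\<^sub>0" "\<epsilon>\<^sub>0 \<le> \<epsilon>" and ij: "i \<in> {1..k}" "j \<in> {1..k}"
  shows "omega T \<epsilon> (F i) (F j) \<le> \<epsilon> / \<epsilon>\<^sub>0 * omega T \<epsilon>\<^sub>0 (F i) (F j)"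
proof (rule omega_leI)
  fix f g assume fg: "f \<in> F i" "g \<in> F j" "norm (g - f) \<le> \<epsilon>"
  define c where "c = \<epsilon>\<^sub>0 / \<epsilon>"
  have c: "0 < c" "c \<le> 1" "c * \<epsilon> = \<epsilon>\<^sub>0" using \<epsilon> by (auto simp: c_def)
  have fgk: "f \<in> F k" "g \<in> F k" using fg F_mono[of i k] F_mono[of j k] ij by auto
  have short: "norm (c *\<^sub>R (g - f)) \<le> \<epsilon>\<^sub>0"
    using mult_left_mono[OF fg(3), of c] c by simp
  have seg: "u + c *\<^sub>R (v - u) \<in> F l" if "u \<in> F l" "v \<in> F l" "l \<in> {1..k}" for u v l
    using convexD_alt[OF convex[OF that(3)] that(1,2), of c] c by (simp add: algebra_simps)
  have "c * (T g - T f) \<le> omega T \<epsilon>\<^sub>0 (F i) (F j)"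
  proof (cases "i \<le> j")
    case True
    then have "f \<in> F j" using F_mono[of i j] fg ij by auto
    then have "T (f + c *\<^sub>R (g - f)) - T f \<le> omega T \<epsilon>\<^sub>0 (F i) (F j)"
      using seg[of f j g] fg ij short \<epsilon> by (intro diff_le_omega) auto
    then show ?thesis by (simp add: T_segment[OF fgk])
  next
    case False
    then have "g \<in> F i" using F_mono[of j i] fg ij by auto
    moreover have "norm (g - (g + c *\<^sub>R (f - g))) \<le> \<epsilon>\<^sub>0"
      using short by (simp add: norm_minus_commute)
    ultimately have "T g - T (g + c *\<^sub>R (f - g)) \<le> omega T \<epsilon>\<^sub>0 (F i) (F j)"
      using seg[of g i f] fg ij \<epsilon> by (intro diff_le_omega) auto
    then show ?thesis using T_segment[OF fgk(2,1), of c] by (simp add: algebra_simps)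
  qed
  then show "T g - T f \<le> \<epsilon> / \<epsilon>\<^sub>0 * omega T \<epsilon>\<^sub>0 (F i) (F j)"
    using c(1) \<epsilon> by (simp add: c_def field_simps)
qed (use \<epsilon> ij in auto)

end

section \<open>Rates and critical radii at a fixed noise level\<close>

locale nested_spaces_noise_level = nested_spaces +
  fixes n :: nat
  assumes n: "1 \<le> n"
begin

abbreviation "A \<equiv> rate T F n"

abbreviation "\<gamma> \<equiv> Defs.gamma T F n"

abbreviation "\<Gamma> \<equiv> gamma_plus T F n"

text \<open>The radius at which \<open>T2 i j\<close> is tuned. With \<Omega> the modulus there, the
  variance bound becomes \<Omega>^2 / ln \<gamma>, and \<open>sqrt (n * var_bound T F n i j)\<close>
  is the slope \<Omega> / \<open>critical i j\<close>.\<close>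

definition critical :: "nat \<Rightarrow> nat \<Rightarrow> real" where
  "critical i j = sqrt (ln (\<gamma> i j) / n)"

definition \<Omega> :: "nat \<Rightarrow> nat \<Rightarrow> real" where
  "\<Omega> i j = omega T (critical i j) (F i) (F j)"

lemma noise_pos: "0 < 1 / sqrt n"
  using n by simp

lemma sqrt_max_exp_1: "exp (1 / 2) \<le> sqrt (max (exp 1) x)" for x :: real
proof -
  have "exp (1 / 2) = sqrt (exp 1)"
    by (rule real_sqrt_unique[symmetric]) (auto simp: power2_eq_square mult_exp_exp)
  then show ?thesis by simp
qed

text \<open>The floor e in the definition of \<gamma>^2 gives \<gamma> at least exp (1 / 2). This
  keeps the critical radii and the division by ln \<gamma> away from 0 and is the source of the
  factors 2 below.\<close>

lemma ln_gamma: "1 / 2 \<le> ln (\<gamma> i j)" "0 < \<gamma> i j"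
  and ln_gamma_plus: "1 / 2 \<le> ln (\<Gamma> i j)" "0 < \<Gamma> i j"
proof -
  have *: "exp (1 / 2) \<le> \<gamma> i j" "exp (1 / 2) \<le> \<Gamma> i j"
    unfolding gamma_def gamma_plus.simps by (rule sqrt_max_exp_1)+
  then show "0 < \<gamma> i j" "0 < \<Gamma> i j"
    using exp_gt_zero[of "1 / 2 :: real"] by linarith+
  then show "1 / 2 \<le> ln (\<gamma> i j)" "1 / 2 \<le> ln (\<Gamma> i j)"
    using * by (metis exp_gt_zero ln_exp ln_mono order_less_le_trans)+
qed

lemma critical_pos: "0 < critical i j"
  using ln_gamma(1)[of i j] n by (simp add: critical_def)

lemma critical_plus_pos: "0 < sqrt (ln (\<Gamma> i j) / n)"
  using ln_gamma_plus(1)[of i j] n by simp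

lemma \<Omega>_pos:
  assumes "i \<in> {1..k}" "j \<in> {1..k}"
  shows "0 < \<Omega> i j"
  unfolding \<Omega>_def using assms critical_pos by (intro omega_pos) auto

lemma A_1: "A 1 = omega T (1 / sqrt n) (F 1) (F 1)"
  by (simp add: rate.simps)

lemma MAX_omega_plus_nonneg:
  assumes "2 \<le> i"
  shows "0 \<le> (MAX m\<in>{1..i - 1}. (omega_plus T (sqrt (ln (\<Gamma> m i) / n)) (F m) (F i))\<^sup>2)"
  using assms by (intro order_trans[OF zero_le_power2 Max_ge[OF _ imageI[of 1]]]) auto

lemma A_square:
  assumes "2 \<le> i"
  shows "(A i)\<^sup>2 = (MAX m\<in>{1..i - 1}. (omega_plus T (sqrt (ln (\<Gamma> m i) / n)) (F m) (F i))\<^sup>2)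
      + (omega T (1 / sqrt n) (F i) (F i))\<^sup>2"
  using MAX_omega_plus_nonneg[OF assms] assms by (subst rate.simps) simp

lemma A_nonneg: "0 \<le> A i" if "i \<in> {1..k}"
proof (cases "i = 1")
  case True
  then show ?thesis using A_1 omega_pos[OF noise_pos, of 1 1] k by simp
next
  case False
  then show ?thesis
    using that MAX_omega_plus_nonneg[of i] by (subst rate.simps) simp
qed

lemma omega_le_A:
  assumes "i \<in> {1..k}"
  shows "omega T (1 / sqrt n) (F i) (F i) \<le> A i"
proof (cases "i = 1")
  case False
  then have i: "2 \<le> i" using assms by auto
  have "(omega T (1 / sqrt n) (F i) (F i))\<^sup>2 \<le> (A i)\<^sup>2"
    using MAX_omega_plus_nonneg[OF i] by (simp add: A_square[OF i])
  then show ?thesis using A_nonneg[OF assms] by (rule power2_le_imp_le)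
qed (use A_1 in simp)

lemma A_pos:
  assumes "i \<in> {1..k}"
  shows "0 < A i"
  using omega_pos[OF noise_pos assms assms] omega_le_A[OF assms] by simp

lemma omega_plus_le_A:
  assumes "1 \<le> m" "m < i" "i \<le> k"
  shows "omega_plus T (sqrt (ln (\<Gamma> m i) / n)) (F m) (F i) \<le> A i"
proof -
  have "(omega_plus T (sqrt (ln (\<Gamma> m i) / n)) (F m) (F i))\<^sup>2
      \<le> (MAX m\<in>{1..i - 1}. (omega_plus T (sqrt (ln (\<Gamma> m i) / n)) (F m) (F i))\<^sup>2)"
    using assms by (intro Max_ge imageI) auto
  also have "\<dots> \<le> (A i)\<^sup>2" using assms by (simp add: A_square)
  finally show ?thesis by (rule power2_le_imp_le) (use assms in \<open>auto intro: A_nonneg\<close>)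
qed

text \<open>Since \<open>m\<close> is the smaller index in both cases, the denominator is the same
  \<open>A m\<close>; only the numerator grows.\<close>

lemma gamma_plus_mono:
  assumes "1 \<le> m" "m < i" "i \<le> i'" "i' \<le> k"
  shows "\<Gamma> m i \<le> \<Gamma> m i'"
proof -
  have "0 \<le> omega_plus T (1 / sqrt n) (F m) (F i)"
    using assms by (intro less_imp_le omega_plus_pos noise_pos) auto
  moreover have "omega_plus T (1 / sqrt n) (F m) (F i) \<le> omega_plus T (1 / sqrt n) (F m) (F i')"
    using assms noise_pos by (intro omega_plus_mono) auto
  ultimately have "(omega_plus T (1 / sqrt n) (F m) (F i))\<^sup>2 / (A m)\<^sup>2
      \<le> (omega_plus T (1 / sqrt n) (F m) (F i'))\<^sup>2 / (A m)\<^sup>2"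
    by (intro divide_right_mono power_mono) auto
  then show ?thesis
    using assms by (simp add: gamma_plus.simps min_def max.coboundedI2)
qed

text \<open>Each term of the maximum for \<open>i\<close> is compared with the term of the same
  \<open>m\<close> for \<open>j\<close>: the radius grows because \<Gamma> does, and so does the
  second space. For \<open>i = 1\<close> there is no maximum, and the plain modulus in
  \<open>A j\<close> suffices.\<close>

lemma A_mono:
  assumes "1 \<le> i" "i \<le> j" "j \<le> k"
  shows "A i \<le> A j"
proof (cases "i = 1")
  case True
  have "A 1 \<le> omega T (1 / sqrt n) (F j) (F j)"
    unfolding A_1 using assms noise_pos by (intro omega_mono) auto
  also have "\<dots> \<le> A j" using assms by (intro omega_le_A) auto
  finally show ?thesis using True by simp
next
  case False
  let ?a = "\<lambda>m i. (omega_plus T (sqrt (ln (\<Gamma> m i) / n)) (F m) (F i))\<^sup>2"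
  have i: "2 \<le> i" "2 \<le> j" using False assms by auto
  have "(MAX m\<in>{1..i - 1}. ?a m i) \<le> (MAX m\<in>{1..j - 1}. ?a m j)"
  proof (rule Max.boundedI)
    fix x assume "x \<in> (\<lambda>m. ?a m i) ` {1..i - 1}"
    then obtain m where m: "m \<in> {1..i - 1}" "x = ?a m i" by blast
    have "0 \<le> omega_plus T (sqrt (ln (\<Gamma> m i) / n)) (F m) (F i)"
      using m assms by (intro less_imp_le omega_plus_pos critical_plus_pos) auto
    moreover have "omega_plus T (sqrt (ln (\<Gamma> m i) / n)) (F m) (F i) \<le> omega_plus T (sqrt (ln (\<Gamma> m j) / n)) (F m) (F j)"
    proof (rule omega_plus_mono[OF critical_plus_pos])
      have "\<Gamma> m i \<le> \<Gamma> m j" using m assms by (intro gamma_plus_mono) auto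
      then show "sqrt (ln (\<Gamma> m i) / n) \<le> sqrt (ln (\<Gamma> m j) / n)"
        using ln_gamma_plus(2)[of m i] by (intro real_sqrt_le_mono divide_right_mono) auto
    qed (use m assms in auto)
    ultimately have "?a m i \<le> ?a m j" by (intro power_mono)
    also have "\<dots> \<le> (MAX m\<in>{1..j - 1}. ?a m j)"
      using m assms by (intro Max_ge imageI) auto
    finally show "x \<le> (MAX m\<in>{1..j - 1}. ?a m j)" using m by simp
  qed (use i in auto)
  moreover have "(omega T (1 / sqrt n) (F i) (F i))\<^sup>2 \<le> (omega T (1 / sqrt n) (F j) (F j))\<^sup>2"
    using assms noise_pos omega_pos[OF noise_pos, of i i] by (intro power_mono omega_mono) auto
  ultimately have "(A i)\<^sup>2 \<le> (A j)\<^sup>2"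
    unfolding A_square[OF i(1)] A_square[OF i(2)] by (rule add_mono)
  then show ?thesis by (rule power2_le_imp_le) (use assms in \<open>auto intro: A_nonneg\<close>)
qed

text \<open>\<open>omega_plus\<close> is symmetric in the two spaces, so \<gamma> in either order of
  the indices is dominated by the one \<Gamma> that enters the rates.\<close>

lemma gamma_le_gamma_plus:
  assumes "i \<in> {1..k}" "j \<in> {1..k}"
  shows "\<gamma> i j \<le> \<Gamma> (min i j) (max i j)"
proof -
  have eq: "omega_plus T (1 / sqrt n) (F i) (F j) = omega_plus T (1 / sqrt n) (F (min i j)) (F (max i j))"
    using omega_plus_commute[OF noise_pos assms] by (simp add: min_def max_def)
  have "(omega T (1 / sqrt n) (F i) (F j))\<^sup>2 \<le> (omega_plus T (1 / sqrt n) (F (min i j)) (F (max i j)))\<^sup>2"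
    unfolding eq[symmetric] using omega_pos[OF noise_pos assms] omega_le_omega_plus[OF noise_pos assms]
    by (intro power_mono) auto
  then have "(omega T (1 / sqrt n) (F i) (F j))\<^sup>2 / (A (min i j))\<^sup>2
      \<le> (omega_plus T (1 / sqrt n) (F (min i j)) (F (max i j)))\<^sup>2 / (A (min i j))\<^sup>2"
    by (rule divide_right_mono) simp
  moreover have "min (min i j) (max i j) = min i j" by (simp add: min_def max_def)
  ultimately show ?thesis
    unfolding gamma_def gamma_plus.simps by (simp add: max.coboundedI2)
qed

text \<open>The term with index \<open>min i j\<close> in the maximum defining
  \<open>A (max i j)\<close> was made for this: its radius is at least the critical one, and the
  absolute value in \<open>omega_plus\<close> covers both orders.\<close>

lemma \<Omega>_le_A:
  assumes ij: "i \<in> {1..k}" "j \<in> {1..k}" "i \<noteq> j"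
  shows "\<Omega> i j \<le> A (max i j)"
proof -
  let ?\<epsilon> = "sqrt (ln (\<Gamma> (min i j) (max i j)) / n)"
  have "critical i j \<le> ?\<epsilon>"
    unfolding critical_def using gamma_le_gamma_plus[OF ij(1,2)] ln_gamma(2)[of i j]
    by (intro real_sqrt_le_mono divide_right_mono) auto
  then have "\<Omega> i j \<le> omega T ?\<epsilon> (F i) (F j)"
    unfolding \<Omega>_def using ij critical_pos by (intro omega_mono) auto
  also have "\<dots> \<le> omega_plus T ?\<epsilon> (F i) (F j)"
    using ij critical_plus_pos by (intro omega_le_omega_plus) auto
  also have "\<dots> = omega_plus T ?\<epsilon> (F (min i j)) (F (max i j))"
    using omega_plus_commute[OF critical_plus_pos ij(1,2)] by (simp add: min_def max_def)
  also have "\<dots> \<le> A (max i j)"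
    using ij by (intro omega_plus_le_A) auto
  finally show ?thesis .
qed

section \<open>Variance, bias and band of the pairwise estimators\<close>

lemma var_bound_eq: "var_bound T F n i j = (\<Omega> i j)\<^sup>2 / ln (\<gamma> i j)"
  by (simp add: var_bound_def \<Omega>_def critical_def)

lemma var_bound_pos:
  assumes "i \<in> {1..k}" "j \<in> {1..k}"
  shows "0 < var_bound T F n i j"
  using \<Omega>_pos[OF assms] ln_gamma(1)[of i j] by (simp add: var_bound_eq)

lemma var_bound_le_A:
  assumes ij: "i \<in> {1..k}" "j \<in> {1..k}" "i \<noteq> j"
  shows "var_bound T F n i j \<le> 2 * (A (max i j))\<^sup>2"
proof -
  have "(\<Omega> i j)\<^sup>2 \<le> (A (max i j))\<^sup>2"
    using \<Omega>_pos[OF ij(1,2)] \<Omega>_le_A[OF ij] by (intro power_mono) auto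
  also have "\<dots> \<le> (A (max i j))\<^sup>2 * (2 * ln (\<gamma> i j))"
    using mult_left_mono[of 1 "2 * ln (\<gamma> i j)" "(A (max i j))\<^sup>2"] ln_gamma(1)[of i j] by simp
  finally show ?thesis
    using ln_gamma(1)[of i j] by (simp add: var_bound_eq field_simps)
qed

text \<open>Enlarging the radius from 1 / sqrt n to the critical one multiplies the modulus by at
  most sqrt (ln \<gamma>), which the division by ln \<gamma> in the variance bound cancels. What
  remains is the modulus at 1 / sqrt n, at most \<gamma> times the smaller rate by definition of
  \<gamma>. If ln \<gamma> is below 1, the critical radius is the smaller one and monotonicity
  suffices, since 2 ln \<gamma> is at least 1. The factor \<gamma>^2 is kept as an exponential to
  cancel against a tail.\<close>

lemma var_bound_le_gamma:
  assumes ij: "i \<in> {1..k}" "j \<in> {1..k}"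
  shows "var_bound T F n i j \<le> 2 * exp (2 * ln (\<gamma> i j)) * (A (min i j))\<^sup>2"
proof -
  let ?L = "ln (\<gamma> i j)" and ?\<omega> = "omega T (1 / sqrt n) (F i) (F j)"
  have L: "1 / 2 \<le> ?L" by (rule ln_gamma)
  have \<omega>: "0 < ?\<omega>" using omega_pos[OF noise_pos ij] .
  have "(\<Omega> i j)\<^sup>2 \<le> 2 * ?L * ?\<omega>\<^sup>2"
  proof (cases "1 \<le> ?L")
    case True
    have eq: "critical i j / (1 / sqrt n) = sqrt ?L"
      using n by (simp add: critical_def real_sqrt_divide)
    have "1 / sqrt n \<le> critical i j"
      using True n by (simp add: critical_def real_sqrt_divide divide_right_mono)
    then have "\<Omega> i j \<le> sqrt ?L * ?\<omega>"
      unfolding \<Omega>_def eq[symmetric] using ij noise_pos by (intro omega_scale) auto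
    then have "(\<Omega> i j)\<^sup>2 \<le> (sqrt ?L * ?\<omega>)\<^sup>2"
      using \<Omega>_pos[OF ij] by (intro power_mono) auto
    also have "\<dots> = ?L * ?\<omega>\<^sup>2" using True by (simp add: power_mult_distrib)
    also have "\<dots> \<le> 2 * ?L * ?\<omega>\<^sup>2" using L by (intro mult_right_mono) auto
    finally show ?thesis .
  next
    case False
    then have "critical i j \<le> 1 / sqrt n"
      using L n by (simp add: critical_def real_sqrt_divide divide_right_mono)
    then have "\<Omega> i j \<le> ?\<omega>"
      unfolding \<Omega>_def using ij critical_pos by (intro omega_mono) auto
    then have "(\<Omega> i j)\<^sup>2 \<le> ?\<omega>\<^sup>2"
      using \<Omega>_pos[OF ij] by (intro power_mono) auto
    also have "\<dots> \<le> 2 * ?L * ?\<omega>\<^sup>2"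
      using L mult_right_mono[of 1 "2 * ?L" "?\<omega>\<^sup>2"] by simp
    finally show ?thesis .
  qed
  then have "var_bound T F n i j \<le> 2 * ?\<omega>\<^sup>2"
    using L by (simp add: var_bound_eq field_simps)
  also have "?\<omega>\<^sup>2 \<le> (\<gamma> i j)\<^sup>2 * (A (min i j))\<^sup>2"
  proof -
    have "(\<gamma> i j)\<^sup>2 = max (exp 1) (?\<omega>\<^sup>2 / (A (min i j))\<^sup>2)"
      unfolding gamma_def by (rule real_sqrt_pow2) (simp add: le_max_iff_disj)
    then have "?\<omega>\<^sup>2 / (A (min i j))\<^sup>2 \<le> (\<gamma> i j)\<^sup>2" by simp
    then show ?thesis using A_pos[of "min i j"] ij by (simp add: field_simps min_def split: if_splits)
  qed
  also have "(\<gamma> i j)\<^sup>2 = exp (2 * ?L)"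
    using ln_gamma(2)[of i j] by (simp add: exp_double)
  finally show ?thesis by simp
qed

text \<open>The subtracted line has slope \<Omega> / \<open>critical i j\<close>. Up to the critical
  radius the modulus is at most \<Omega>; beyond it, by scaling, the modulus stays below the
  line.\<close>

lemma bias_bound_le:
  assumes ij: "i \<in> {1..k}" "j \<in> {1..k}"
  shows "bias_bound T F n i j \<le> \<Omega> i j / 2"
proof -
  let ?\<epsilon> = "critical i j"
  have L: "1 / 2 \<le> ln (\<gamma> i j)" by (rule ln_gamma)
  have "n * var_bound T F n i j = (\<Omega> i j / ?\<epsilon>)\<^sup>2"
    using L n by (simp add: var_bound_eq critical_def power_divide)
  then have slope: "sqrt (n * var_bound T F n i j) = \<Omega> i j / ?\<epsilon>"
    using \<Omega>_pos[OF ij] critical_pos[of i j] by simp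
  have "omega T \<epsilon> (F i) (F j) - \<Omega> i j / ?\<epsilon> * \<epsilon> \<le> \<Omega> i j" if "0 < \<epsilon>" for \<epsilon>
  proof (cases "\<epsilon> \<le> ?\<epsilon>")
    case True
    have "omega T \<epsilon> (F i) (F j) \<le> \<Omega> i j"
      unfolding \<Omega>_def using True that ij by (intro omega_mono) auto
    moreover have "0 \<le> \<Omega> i j / ?\<epsilon> * \<epsilon>" using that \<Omega>_pos[OF ij] critical_pos[of i j] by simp
    ultimately show ?thesis by linarith
  next
    case False
    have "omega T \<epsilon> (F i) (F j) \<le> \<epsilon> / ?\<epsilon> * \<Omega> i j"
      unfolding \<Omega>_def using False ij critical_pos by (intro omega_scale) auto
    then show ?thesis using \<Omega>_pos[OF ij] by (simp add: mult.commute)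
  qed
  then have "(SUP \<epsilon>\<in>{0<..}. omega T \<epsilon> (F i) (F j) - \<Omega> i j / ?\<epsilon> * \<epsilon>) \<le> \<Omega> i j"
    by (intro cSUP_least) auto
  then show ?thesis unfolding bias_bound_def slope by simp
qed

lemma band_eq: "band T F n i j = omega T (1 / sqrt n) (F (min i j)) (F (min i j)) + \<Omega> i j"
  by (simp add: band_def \<Omega>_def critical_def)

end

section \<open>Risk of the adaptive estimator\<close>

text \<open>The \<open>j - i\<close> consecutive ratios multiply to \<open>a i / a j\<close>, so one
  of them is at most their geometric mean, stated with powers to avoid roots. Otherwise, multiplying
  the opposite inequalities would put \<open>(a i / a j) ^ (j - i)\<close> strictly below
  itself.\<close>

lemma exists_small_ratio:
  fixes a :: "nat \<Rightarrow> real"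
  assumes "i < j" and pos: "\<And>s. i \<le> s \<Longrightarrow> s \<le> j \<Longrightarrow> 0 < a s"
  shows "\<exists>s\<in>{i..<j}. (a s / a (Suc s)) ^ (j - i) \<le> a i / a j"
proof (rule ccontr)
  assume "\<not> ?thesis"
  then have lt: "a i / a j < (a s / a (Suc s)) ^ (j - i)" if "s \<in> {i..<j}" for s
    using that by force
  have nonneg: "0 \<le> a i / a j" using pos[of i] pos[of j] assms(1) by simp
  have "(\<Prod>s\<in>{i..<j}. a i / a j) < (\<Prod>s\<in>{i..<j}. (a s / a (Suc s)) ^ (j - i))"
    using assms(1) nonneg lt le_less_trans[OF nonneg lt]
    by (intro prod_mono_strict) (auto intro: less_imp_le)
  also have "\<dots> = (\<Prod>s\<in>{i..<j}. a s / a (Suc s)) ^ (j - i)"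
    by (rule prod_power_distrib[symmetric])
  also have "(\<Prod>s\<in>{i..<j}. a s / a (Suc s)) = a i / a j"
    using less_imp_le[OF assms(1)] pos
  proof (induction j rule: dec_induct)
    case (step m)
    then have "(\<Prod>s\<in>{i..<m}. a s / a (Suc s)) = a i / a m" by simp
    then show ?case using step by (simp add: less_imp_neq[symmetric])
  qed (simp add: less_imp_neq[symmetric])
  finally show False by simp
qed

text \<open>Trades exponential decay for a power of a ratio of rates, the form in which
  \<open>exists_small_ratio\<close> can be applied.\<close>

lemma exp_minus_le_power: "exp (- (real m * y)) \<le> (1 / y) ^ m" if "0 < y"
proof -
  have "y \<le> exp y" using exp_ge_add_one_self[of y] by linarith
  then have "exp (- y) \<le> 1 / y"
    using that by (simp add: exp_minus field_simps)
  then have "exp (- y) ^ m \<le> (1 / y) ^ m" by (intro power_mono) auto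
  then show ?thesis by (simp add: exp_of_nat_mult[symmetric])
qed

text \<open>In units of \<open>A i\<close>: the bias \<Omega> / 2 of \<open>T2\<close> costs 1 / 2,
  a band is at most 2 and enters with its factor, and the slack is added.\<close>

definition accept_const :: "nat \<Rightarrow> real" where
  "accept_const k = 1 / 2 + 2 * (4 * sqrt (2 * k) + 1) + 4 * sqrt k"

text \<open>The summands stand for the correct space, for at most \<open>k\<close> smaller and for
  at most \<open>k\<close> larger spaces.\<close>

definition risk_const :: "nat \<Rightarrow> real" where
  "risk_const k = 1 + k * (3 * (accept_const k)\<^sup>2 + 12) + k * (k * 4 ^ (k + 1) + 776)"

locale adaptive_estimation = nested_spaces_noise_level +
  fixes M :: "'w measure" and W :: "real \<Rightarrow> 'w \<Rightarrow> real"
    and T1 :: "nat \<Rightarrow> 'w estimator" and T2 :: "nat \<Rightarrow> nat \<Rightarrow> 'w estimator"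
  assumes noise: "standard_brownian_motion M W"
    and blocks: "building_blocks M W T F k n T1 T2"
begin

sublocale prob_space M
  using noise by (simp add: standard_brownian_motion_def)

section \<open>Moments of the centred building blocks\<close>

definition Z1 :: "nat \<Rightarrow> 'w estimator" where
  "Z1 i f \<omega> = T1 i f \<omega> - expectation (T1 i f)"

definition Z2 :: "nat \<Rightarrow> nat \<Rightarrow> 'w estimator" where
  "Z2 i j f \<omega> = T2 i j f \<omega> - expectation (T2 i j f)"

lemma T1_measurable: "i \<in> {1..k} \<Longrightarrow> T1 i f \<in> borel_measurable M"
  and T2_measurable: "i \<in> {1..k} \<Longrightarrow> j \<in> {1..k} \<Longrightarrow> i \<noteq> j \<Longrightarrow> T2 i j f \<in> borel_measurable M"
  using blocks by (auto simp: building_blocks_def intro!: linear_estimator_subgaussian(1)[OF noise, where n = n])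

text \<open>The quadratic risk is variance plus squared bias, so its bound applies to each of the
  two separately.\<close>

lemma T1_moments:
  assumes i: "i \<in> {1..k}" and f: "f \<in> F i"
  shows "\<bar>expectation (T1 i f) - T f\<bar> \<le> omega T (1 / sqrt n) (F i) (F i)"
    and "subgaussian M (Z1 i f) ((omega T (1 / sqrt n) (F i) (F i))\<^sup>2)"
    and "mse M T (T1 i) f \<le> ennreal ((omega T (1 / sqrt n) (F i) (F i))\<^sup>2)"
proof -
  let ?w = "omega T (1 / sqrt n) (F i) (F i)" and ?X = "T1 i f"
  have lin: "linear_estimator M W n (T1 i)"
    and risk: "(SUP f\<in>F i. mse M T (T1 i) f) \<le> ennreal (?w\<^sup>2)"
    using blocks i by (auto simp: building_blocks_def)
  note X = linear_estimator_subgaussian[OF noise lin, of f]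
  have int: "integrable M ?X" by (rule square_integrable_imp_integrable[OF X(1,2)])
  show mse: "mse M T (T1 i) f \<le> ennreal (?w\<^sup>2)"
    using f by (intro order_trans[OF SUP_upper risk])
  have "integrable M (\<lambda>\<omega>. (?X \<omega> - T f)\<^sup>2)"
    using X(2) int by (simp add: power2_diff)
  then have "mse M T (T1 i) f = ennreal (expectation (\<lambda>\<omega>. (?X \<omega> - T f)\<^sup>2))"
    unfolding mse_def by (rule nn_integral_eq_integral) simp
  with mse have le: "expectation (\<lambda>\<omega>. (?X \<omega> - T f)\<^sup>2) \<le> ?w\<^sup>2"
    by (simp add: ennreal_le_iff)
  have split: "expectation (\<lambda>\<omega>. (?X \<omega> - T f)\<^sup>2) = variance ?X + (expectation ?X - T f)\<^sup>2"
    by (rule expectation_square_shift[OF int X(2)])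
  have "variance ?X \<le> ?w\<^sup>2"
    using le split zero_le_power2[of "expectation ?X - T f"] by linarith
  with X(3) show "subgaussian M (Z1 i f) (?w\<^sup>2)"
    unfolding Z1_def[abs_def] by (rule subgaussian_mono)
  have "(expectation ?X - T f)\<^sup>2 \<le> ?w\<^sup>2"
    using le split variance_positive[of ?X] by linarith
  then have "\<bar>expectation ?X - T f\<bar> \<le> \<bar>?w\<bar>" by (simp add: abs_le_square_iff)
  then show "\<bar>expectation ?X - T f\<bar> \<le> ?w"
    using omega_pos[OF noise_pos i i] by simp
qed

text \<open>The two bias bounds are one-sided and hold on different spaces; this is why each
  comparison uses \<open>T2\<close> in both orders.\<close>

lemma T2_moments:
  assumes ij: "i \<in> {1..k}" "j \<in> {1..k}" "i \<noteq> j"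
  shows "f \<in> F i \<Longrightarrow> expectation (T2 i j f) - T f \<le> \<Omega> i j / 2"
    and "f \<in> F j \<Longrightarrow> - (\<Omega> i j / 2) \<le> expectation (T2 i j f) - T f"
    and "subgaussian M (Z2 i j f) (var_bound T F n i j)"
    and "(\<integral>\<^sup>+\<omega>. ennreal ((Z2 i j f \<omega>)\<^sup>2) \<partial>M) \<le> ennreal (var_bound T F n i j)"
proof -
  have lin: "linear_estimator M W n (T2 i j)"
    and var: "variance (T2 i j f) \<le> var_bound T F n i j"
    and upper: "f \<in> F i \<Longrightarrow> expectation (T2 i j f) - T f \<le> bias_bound T F n i j"
    and lower: "f \<in> F j \<Longrightarrow> - bias_bound T F n i j \<le> expectation (T2 i j f) - T f"
    using blocks ij unfolding building_blocks_def by blast+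
  show "f \<in> F i \<Longrightarrow> expectation (T2 i j f) - T f \<le> \<Omega> i j / 2"
    and "f \<in> F j \<Longrightarrow> - (\<Omega> i j / 2) \<le> expectation (T2 i j f) - T f"
    using upper lower bias_bound_le[OF ij(1,2)] by auto
  note X = linear_estimator_subgaussian[OF noise lin, of f]
  show "subgaussian M (Z2 i j f) (var_bound T F n i j)"
    unfolding Z2_def[abs_def] using X(3) var by (rule subgaussian_mono)
  have "integrable M (\<lambda>\<omega>. (Z2 i j f \<omega>)\<^sup>2)"
    using X(2) square_integrable_imp_integrable[OF X(1,2)] by (simp add: Z2_def power2_diff)
  then have "(\<integral>\<^sup>+\<omega>. ennreal ((Z2 i j f \<omega>)\<^sup>2) \<partial>M) = ennreal (variance (T2 i j f))"
    unfolding Z2_def by (rule nn_integral_eq_integral) simp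
  then show "(\<integral>\<^sup>+\<omega>. ennreal ((Z2 i j f \<omega>)\<^sup>2) \<partial>M) \<le> ennreal (var_bound T F n i j)"
    using var by (simp add: ennreal_leI)
qed

lemma Z1_measurable: "i \<in> {1..k} \<Longrightarrow> Z1 i f \<in> borel_measurable M"
  and Z2_measurable: "i \<in> {1..k} \<Longrightarrow> j \<in> {1..k} \<Longrightarrow> i \<noteq> j \<Longrightarrow> Z2 i j f \<in> borel_measurable M"
  using T1_measurable T2_measurable by (auto simp: Z1_def[abs_def] Z2_def[abs_def])

subsection \<open>Selecting too small a space\<close>

text \<open>As \<open>f\<close> need not lie in \<open>F j\<close>, the bias of \<open>T1 j\<close>
  is out of control. Acceptance however encloses \<open>T1 j\<close> between \<open>T2 j i\<close>
  and \<open>T2 i j\<close>, up to bands and slack, and the lower bias bound of the former and the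
  upper one of the latter both hold on \<open>F i\<close>.\<close>

lemma accepted_error:
  assumes ji: "1 \<le> j" "j < i" "i \<le> k" and f: "f \<in> F i"
    and accept: "pair_indicator T F k n T1 T2 j i f \<omega> = 1"
  shows "\<bar>T1 j f \<omega> - T f\<bar> \<le> accept_const k * A i + \<bar>Z2 j i f \<omega>\<bar> + \<bar>Z2 i j f \<omega>\<bar>"
proof -
  let ?c = "4 * sqrt (2 * k) + 1"
  have idx: "i \<in> {1..k}" "j \<in> {1..k}" "i \<noteq> j" "j \<noteq> i" and mm: "max i j = i" "max j i = i" "min i j = j" "min j i = j"
    using ji by auto
  have \<Omega>: "\<Omega> i j \<le> A i" "\<Omega> j i \<le> A i"
    using \<Omega>_le_A[OF idx(1,2,3)] \<Omega>_le_A[OF idx(2,1,4)] mm by auto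
  have "omega T (1 / sqrt n) (F j) (F j) \<le> A i"
    using omega_le_A[OF idx(2)] A_mono[of j i] ji by simp
  then have band: "band T F n i j \<le> 2 * A i" "band T F n j i \<le> 2 * A i"
    using \<Omega> by (simp_all add: band_eq mm)
  have c: "?c * band T F n i j \<le> ?c * (2 * A i)" "?c * band T F n j i \<le> ?c * (2 * A i)"
    using band by (intro mult_left_mono; simp)+
  have "T2 j i f \<omega> - ?c * band T F n j i - 4 * sqrt k * A i \<le> T1 j f \<omega>"
    "T1 j f \<omega> \<le> T2 i j f \<omega> + ?c * band T F n i j + 4 * sqrt k * A i"
    using accept unfolding pair_indicator_def by (auto split: if_splits)
  moreover have "- (\<Omega> j i / 2) \<le> expectation (T2 j i f) - T f" "expectation (T2 i j f) - T f \<le> \<Omega> i j / 2"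
    using T2_moments(2)[OF idx(2,1,4)] T2_moments(1)[OF idx(1,2,3)] f by auto
  moreover have "accept_const k * A i = A i / 2 + ?c * (2 * A i) + 4 * sqrt k * A i"
    by (simp add: accept_const_def algebra_simps)
  ultimately show ?thesis
    using \<Omega> c unfolding Z2_def by linarith
qed

text \<open>The square of a sum of three terms is at most 3 times the sum of squares; each variance
  is at most 2 \<open>(A i)^2\<close>, which gives 12 = 3 * 2 + 3 * 2.\<close>

lemma accepted_risk:
  assumes ji: "1 \<le> j" "j < i" "i \<le> k"
  shows "(\<integral>\<^sup>+\<omega>. ennreal ((accept_const k * A i + \<bar>Z2 j i f \<omega>\<bar> + \<bar>Z2 i j f \<omega>\<bar>)\<^sup>2) \<partial>M)
    \<le> ennreal ((3 * (accept_const k)\<^sup>2 + 12) * (A i)\<^sup>2)"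
proof -
  have idx: "i \<in> {1..k}" "j \<in> {1..k}" "i \<noteq> j" "j \<noteq> i" and mm: "max i j = i" "max j i = i"
    using ji by auto
  note [measurable] = Z2_measurable[OF idx(1,2,3), of f] Z2_measurable[OF idx(2,1,4), of f]
  let ?b = "accept_const k * A i"
  have "(\<integral>\<^sup>+\<omega>. ennreal ((?b + \<bar>Z2 j i f \<omega>\<bar> + \<bar>Z2 i j f \<omega>\<bar>)\<^sup>2) \<partial>M)
      \<le> (\<integral>\<^sup>+\<omega>. ennreal (3 * ?b\<^sup>2) + (ennreal 3 * ennreal ((Z2 j i f \<omega>)\<^sup>2) + ennreal 3 * ennreal ((Z2 i j f \<omega>)\<^sup>2)) \<partial>M)"
  proof (rule nn_integral_mono)
    fix \<omega>
    have "(x + y + z)\<^sup>2 \<le> 3 * x\<^sup>2 + (3 * y\<^sup>2 + 3 * z\<^sup>2)" for x y z :: real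
      using zero_le_power2[of "x - y"] zero_le_power2[of "y - z"] zero_le_power2[of "x - z"]
      by (simp add: power2_eq_square algebra_simps)
    from this[of ?b "\<bar>Z2 j i f \<omega>\<bar>" "\<bar>Z2 i j f \<omega>\<bar>"]
    show "ennreal ((?b + \<bar>Z2 j i f \<omega>\<bar> + \<bar>Z2 i j f \<omega>\<bar>)\<^sup>2)
        \<le> ennreal (3 * ?b\<^sup>2) + (ennreal 3 * ennreal ((Z2 j i f \<omega>)\<^sup>2) + ennreal 3 * ennreal ((Z2 i j f \<omega>)\<^sup>2))"
      by (simp add: ennreal_mult'[symmetric] ennreal_plus[symmetric] ennreal_leI del: ennreal_plus ennreal_numeral)
  qed
  also have "\<dots> = ennreal (3 * ?b\<^sup>2) + (ennreal 3 * (\<integral>\<^sup>+\<omega>. ennreal ((Z2 j i f \<omega>)\<^sup>2) \<partial>M)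
      + ennreal 3 * (\<integral>\<^sup>+\<omega>. ennreal ((Z2 i j f \<omega>)\<^sup>2) \<partial>M))"
    by (simp add: nn_integral_add nn_integral_cmult emeasure_space_1)
  also have "\<dots> \<le> ennreal (3 * ?b\<^sup>2) + (ennreal 3 * ennreal (2 * (A i)\<^sup>2) + ennreal 3 * ennreal (2 * (A i)\<^sup>2))"
    using var_bound_le_A[OF idx(1,2,3)] var_bound_le_A[OF idx(2,1,4)] mm
    by (intro add_mono mult_left_mono order_refl order_trans[OF T2_moments(4)] ennreal_leI idx zero_le) auto
  also have "\<dots> = ennreal ((3 * (accept_const k)\<^sup>2 + 12) * (A i)\<^sup>2)"
    by (simp add: ennreal_mult'[symmetric] ennreal_plus[symmetric] power_mult_distrib algebra_simps del: ennreal_plus ennreal_numeral)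
  finally show ?thesis .
qed

subsection \<open>Selecting too large a space\<close>

text \<open>Half of the slack, \<open>2 * sqrt k * A m\<close>, yields the exponent 2 k times (A_m /
  w)^2, where the standard deviation is at most w and w is at most \<open>A s\<close>; as a power
  this is (w / A_m)^(4 k).\<close>

lemma Z1_tail:
  assumes sm: "1 \<le> s" "s < m" "m \<le> k" and f: "f \<in> F s" and Z: "Z = Z1 s f \<or> Z = (\<lambda>\<omega>. - Z1 s f \<omega>)"
  shows "emeasure M {\<omega>\<in>space M. 2 * sqrt k * A m \<le> Z \<omega>} \<le> ennreal (4 ^ k * (A s / A m) ^ (4 * k))"
proof -
  have s: "s \<in> {1..k}" and Am: "0 < A m" "0 < A s" using sm A_pos by auto
  let ?w = "omega T (1 / sqrt n) (F s) (F s)"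
  have w: "0 < ?w" "?w \<le> A s" using omega_pos[OF noise_pos s s] omega_le_A[OF s] by auto
  have "subgaussian M Z (?w\<^sup>2)"
    using Z T1_moments(2)[OF s f] subgaussian_uminus by blast
  then have "emeasure M {\<omega>\<in>space M. 2 * sqrt k * A m \<le> Z \<omega>} \<le> ennreal (exp (- ((2 * sqrt k * A m)\<^sup>2 / (2 * ?w\<^sup>2))))"
    using w Am k by (intro subgaussian_tail) auto
  also have "(2 * sqrt k * A m)\<^sup>2 / (2 * ?w\<^sup>2) = real (2 * k) * (A m / ?w)\<^sup>2"
    by (simp add: power_mult_distrib power_divide)
  also have "exp (- (real (2 * k) * (A m / ?w)\<^sup>2)) \<le> (1 / (A m / ?w)\<^sup>2) ^ (2 * k)"
    using Am w by (intro exp_minus_le_power) simp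
  also have "\<dots> = (?w / A m) ^ (4 * k)"
    by (simp add: power_divide power_mult[symmetric])
  also have "\<dots> \<le> (A s / A m) ^ (4 * k)"
    using Am w by (intro power_mono divide_right_mono) auto
  \<comment> \<open>The factor \<open>4 ^ k\<close> only brings the bound to the form shared with
    \<open>Z2_tail\<close>.\<close>
  also have "\<dots> \<le> 4 ^ k * (A s / A m) ^ (4 * k)"
    using Am mult_right_mono[of 1 "4 ^ k" "(A s / A m) ^ (4 * k)"] by simp
  finally show ?thesis by (simp add: ennreal_leI)
qed

text \<open>The two summands of the threshold have separate duties. The rate part gives (V /
  A_m^2)^(2 k), which in terms of \<open>A s\<close> is 4^k \<gamma>^(4 k) (A_s / A_m)^(4 k). The
  \<Omega> part gives \<gamma>^(-16 k), as \<Omega>^2 = V ln \<gamma>, and absorbs the power of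
  \<gamma>.\<close>

lemma Z2_tail:
  assumes sm: "1 \<le> s" "s < m" "m \<le> k" and ij: "i = s \<and> j = m \<or> i = m \<and> j = s"
    and Z: "Z = Z2 i j f \<or> Z = (\<lambda>\<omega>. - Z2 i j f \<omega>)"
  shows "emeasure M {\<omega>\<in>space M. 4 * sqrt (2 * k) * \<Omega> i j + 2 * sqrt k * A m \<le> Z \<omega>}
    \<le> ennreal (4 ^ k * (A s / A m) ^ (4 * k))"
proof -
  have idx: "i \<in> {1..k}" "j \<in> {1..k}" "i \<noteq> j" and mn: "min i j = s" using sm ij by auto
  have Am: "0 < A m" "0 < A s" using sm A_pos by auto
  let ?V = "var_bound T F n i j" and ?L = "ln (\<gamma> i j)"
  let ?x = "4 * sqrt (2 * k) * \<Omega> i j + 2 * sqrt k * A m"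
  have L: "0 < ?L" using ln_gamma(1)[of i j] by simp
  have \<Omega>: "0 < \<Omega> i j" by (rule \<Omega>_pos[OF idx(1,2)])
  have V: "0 < ?V" by (rule var_bound_pos[OF idx(1,2)])
  have x: "0 < ?x" using \<Omega> Am k by (intro add_pos_pos mult_pos_pos) auto
  have "subgaussian M Z ?V"
    using Z T2_moments(3)[OF idx] subgaussian_uminus by blast
  then have "emeasure M {\<omega>\<in>space M. ?x \<le> Z \<omega>} \<le> ennreal (exp (- (?x\<^sup>2 / (2 * ?V))))"
    using V x by (rule subgaussian_tail)
  also have "exp (- (?x\<^sup>2 / (2 * ?V))) \<le> 4 ^ k * (A s / A m) ^ (4 * k)"
  proof -
    have "(4 * sqrt (2 * k) * \<Omega> i j)\<^sup>2 + (2 * sqrt k * A m)\<^sup>2 \<le> ?x\<^sup>2"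
      using \<Omega> Am by (simp add: power2_sum)
    then have "32 * k * (\<Omega> i j)\<^sup>2 + 4 * k * (A m)\<^sup>2 \<le> ?x\<^sup>2"
      by (simp add: power_mult_distrib)
    moreover have "(\<Omega> i j)\<^sup>2 = ?V * ?L" using L by (simp add: var_bound_eq)
    ultimately have "(32 * k * (?V * ?L) + 4 * k * (A m)\<^sup>2) / (2 * ?V) \<le> ?x\<^sup>2 / (2 * ?V)"
      using V by (intro divide_right_mono) auto
    moreover have "(32 * k * (?V * ?L) + 4 * k * (A m)\<^sup>2) / (2 * ?V) = 16 * k * ?L + real (2 * k) * ((A m)\<^sup>2 / ?V)"
      using V by (simp add: field_simps)
    ultimately have "exp (- (?x\<^sup>2 / (2 * ?V))) \<le> exp (- (16 * k * ?L)) * exp (- (real (2 * k) * ((A m)\<^sup>2 / ?V)))"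
      by (simp add: mult_exp_exp)
    also have "\<dots> \<le> exp (- (16 * k * ?L)) * (1 / ((A m)\<^sup>2 / ?V)) ^ (2 * k)"
      using Am V by (intro mult_left_mono exp_minus_le_power) auto
    also have "\<dots> \<le> exp (- (16 * k * ?L)) * (2 * exp (2 * ?L) * (A s / A m)\<^sup>2) ^ (2 * k)"
    proof (intro mult_left_mono power_mono)
      show "1 / ((A m)\<^sup>2 / ?V) \<le> 2 * exp (2 * ?L) * (A s / A m)\<^sup>2"
        using var_bound_le_gamma[OF idx(1,2)] Am by (simp add: mn power_divide divide_right_mono)
    qed (use V in auto)
    also have "\<dots> = exp (- (12 * k * ?L)) * (4 ^ k * (A s / A m) ^ (4 * k))"
    proof -
      have "(exp (2 * ?L)) ^ (2 * k) = exp (4 * k * ?L)"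
        by (simp add: exp_of_nat_mult[symmetric])
      then have "exp (- (16 * k * ?L)) * (exp (2 * ?L)) ^ (2 * k) = exp (- (12 * k * ?L))"
        by (simp add: mult_exp_exp)
      moreover have "(2 :: real) ^ (2 * k) = 4 ^ k" "((A s / A m)\<^sup>2) ^ (2 * k) = (A s / A m) ^ (4 * k)"
        by (simp_all add: power_mult power_mult[symmetric, of _ 2 "2 * k"])
      ultimately show ?thesis by (simp add: power_mult_distrib)
    qed
    also have "\<dots> \<le> 4 ^ k * (A s / A m) ^ (4 * k)"
      using L Am by (intro mult_left_le_one_le) auto
    finally show ?thesis .
  qed
  finally show ?thesis by (simp add: ennreal_leI)
qed

lemma pair_indicator_measurable:
  assumes "1 \<le> s" "s < m" "m \<le> k"
  shows "pair_indicator T F k n T1 T2 s m f \<in> borel_measurable M"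
proof -
  have idx: "s \<in> {1..k}" "m \<in> {1..k}" "s \<noteq> m" "m \<noteq> s" using assms by auto
  note [measurable] = T1_measurable[OF idx(1), of f] T2_measurable[OF idx(1,2,3), of f] T2_measurable[OF idx(2,1,4), of f]
  show ?thesis unfolding pair_indicator_def[abs_def] by measurable
qed

text \<open>Either inequality of the test can fail, and each failure forces one of two centred
  variables over its threshold: four events of probability at most \<open>4 ^ k\<close> times the
  power.\<close>

lemma reject_prob:
  assumes sm: "1 \<le> s" "s < m" "m \<le> k" and f: "f \<in> F s"
  shows "emeasure M {\<omega>\<in>space M. pair_indicator T F k n T1 T2 s m f \<omega> = 0}
    \<le> ennreal (4 ^ (k + 1) * (A s / A m) ^ (4 * k))"
proof -
  have idx: "s \<in> {1..k}" "m \<in> {1..k}" "s \<noteq> m" "m \<noteq> s" and mm: "min s m = s" "min m s = s" using sm by auto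
  note [measurable] = Z1_measurable[OF idx(1), of f] Z2_measurable[OF idx(1,2,3), of f] Z2_measurable[OF idx(2,1,4), of f]
  let ?x = "\<lambda>i j. 4 * sqrt (2 * k) * \<Omega> i j + 2 * sqrt k * A m"
  define E1 where "E1 = {\<omega>\<in>space M. ?x s m \<le> Z2 s m f \<omega>}"
  define E2 where "E2 = {\<omega>\<in>space M. 2 * sqrt k * A m \<le> - Z1 s f \<omega>}"
  define E3 where "E3 = {\<omega>\<in>space M. ?x m s \<le> - Z2 m s f \<omega>}"
  define E4 where "E4 = {\<omega>\<in>space M. 2 * sqrt k * A m \<le> Z1 s f \<omega>}"
  let ?p = "4 ^ k * (A s / A m) ^ (4 * k)"
  have p: "emeasure M E1 \<le> ennreal ?p" "emeasure M E2 \<le> ennreal ?p"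
      "emeasure M E3 \<le> ennreal ?p" "emeasure M E4 \<le> ennreal ?p"
    unfolding E1_def E2_def E3_def E4_def
    using Z2_tail[OF sm, of s m "Z2 s m f" f] Z1_tail[OF sm f, of "\<lambda>\<omega>. - Z1 s f \<omega>"]
      Z2_tail[OF sm, of m s "\<lambda>\<omega>. - Z2 m s f \<omega>" f] Z1_tail[OF sm f, of "Z1 s f"] by blast+
  have sets: "E1 \<in> sets M" "E2 \<in> sets M" "E3 \<in> sets M" "E4 \<in> sets M"
    unfolding E1_def E2_def E3_def E4_def by measurable
  have "{\<omega>\<in>space M. pair_indicator T F k n T1 T2 s m f \<omega> = 0} \<subseteq> (E1 \<union> E2) \<union> (E3 \<union> E4)"
  proof
    fix \<omega> assume "\<omega> \<in> {\<omega>\<in>space M. pair_indicator T F k n T1 T2 s m f \<omega> = 0}"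
    then have \<omega>: "\<omega> \<in> space M" and zero: "pair_indicator T F k n T1 T2 s m f \<omega> = 0" by auto
    let ?w = "omega T (1 / sqrt n) (F s) (F s)" and ?r = "4 * sqrt (2 * k)"
    have w: "0 < ?w" using omega_pos[OF noise_pos idx(1,1)] .
    have rw: "0 \<le> ?r * ?w" using w by simp
    have \<Omega>: "0 < \<Omega> s m" "0 < \<Omega> m s" using \<Omega>_pos idx by auto
    have bias1: "\<bar>expectation (T1 s f) - T f\<bar> \<le> ?w" by (rule T1_moments(1)[OF idx(1) f])
    have "f \<in> F m" using F_mono[of s m] sm f by auto
    then have bias2: "expectation (T2 s m f) - T f \<le> \<Omega> s m / 2" "- (\<Omega> m s / 2) \<le> expectation (T2 m s f) - T f"
      using T2_moments(1)[OF idx(1,2,3)] T2_moments(2)[OF idx(2,1,4)] f by auto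
    \<comment> \<open>In the expanded band, \<open>?w\<close> absorbs the bias of \<open>T1\<close>
      and the single \<Omega> that of \<open>T2\<close>; \<open>?r\<close> times \<Omega> is left
      for the noise of \<open>T2\<close>, and the slack is halved between the two centred
      variables.\<close>
    have band: "(?r + 1) * band T F n s m = ?r * ?w + ?r * \<Omega> s m + ?w + \<Omega> s m"
      "(?r + 1) * band T F n m s = ?r * ?w + ?r * \<Omega> m s + ?w + \<Omega> m s"
      by (simp_all add: band_eq mm algebra_simps)
    consider "T1 s f \<omega> < T2 s m f \<omega> - (?r + 1) * band T F n s m - 4 * sqrt k * A m"
      | "T2 m s f \<omega> + (?r + 1) * band T F n m s + 4 * sqrt k * A m < T1 s f \<omega>"
      using zero unfolding pair_indicator_def by (auto simp: not_le)
    then show "\<omega> \<in> (E1 \<union> E2) \<union> (E3 \<union> E4)"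
    proof cases
      case 1
      then have "?x s m \<le> Z2 s m f \<omega> \<or> 2 * sqrt k * A m \<le> - Z1 s f \<omega>"
        using bias1 bias2 w rw \<Omega> unfolding band Z1_def Z2_def by linarith
      then show ?thesis using \<omega> by (auto simp: E1_def E2_def)
    next
      case 2
      then have "?x m s \<le> - Z2 m s f \<omega> \<or> 2 * sqrt k * A m \<le> Z1 s f \<omega>"
        using bias1 bias2 w rw \<Omega> unfolding band Z1_def Z2_def by linarith
      then show ?thesis using \<omega> by (auto simp: E3_def E4_def)
    qed
  qed
  then have "emeasure M {\<omega>\<in>space M. pair_indicator T F k n T1 T2 s m f \<omega> = 0} \<le> emeasure M ((E1 \<union> E2) \<union> (E3 \<union> E4))"
    using sets by (intro emeasure_mono) auto
  also have "\<dots> \<le> (emeasure M E1 + emeasure M E2) + (emeasure M E3 + emeasure M E4)"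
    using sets by (intro order_trans[OF emeasure_subadditive] add_mono emeasure_subadditive) auto
  also have "\<dots> \<le> (ennreal ?p + ennreal ?p) + (ennreal ?p + ennreal ?p)"
    by (intro add_mono p)
  also have "\<dots> = ennreal (4 ^ (k + 1) * (A s / A m) ^ (4 * k))"
    using A_pos[OF idx(1)] A_pos[OF idx(2)] by (simp add: ennreal_plus[symmetric] del: ennreal_plus)
  finally show ?thesis .
qed

text \<open>Every space between \<open>i\<close> and \<open>j\<close> is rejected when \<open>j\<close> is selected; the event below is the rejection
  of one across which the rate jumps by at least the geometric mean of the jumps.\<close>

lemma overshoot_event:
  assumes ij: "1 \<le> i" "i < j" "j \<le> k" and f: "f \<in> F i"
  obtains B where "B \<in> sets M"
    and "\<And>\<omega>. \<omega> \<in> space M \<Longrightarrow> (\<And>s. s \<in> {i..<j} \<Longrightarrow> all_indicator T F k n T1 T2 s f \<omega> = 0) \<Longrightarrow> \<omega> \<in> B"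
    and "emeasure M B \<le> ennreal (k * 4 ^ (k + 1) * (A i / A j) ^ 4)"
proof -
  have "\<exists>s\<in>{i..<j}. (A s / A (Suc s)) ^ (j - i) \<le> A i / A j"
    using ij by (intro exists_small_ratio A_pos) auto
  then obtain s where s: "i \<le> s" "s < j" and ratio: "(A s / A (Suc s)) ^ (j - i) \<le> A i / A j" by auto
  let ?R = "\<lambda>m. {\<omega>\<in>space M. pair_indicator T F k n T1 T2 s m f \<omega> = 0}"
  define B where "B = (\<Union>m\<in>{s<..k}. ?R m)"
  have R: "?R m \<in> sets M" if "m \<in> {s<..k}" for m
  proof -
    have [measurable]: "pair_indicator T F k n T1 T2 s m f \<in> borel_measurable M"
      using that s ij by (intro pair_indicator_measurable) auto
    show ?thesis by measurable
  qed
  have fs: "f \<in> F s" using F_mono[of i s] f s ij by auto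
  have pos: "0 < A s" "0 < A (Suc s)" "0 < A i" "0 < A j" using s ij by (auto intro!: A_pos)
  have prob: "emeasure M (?R m) \<le> ennreal (4 ^ (k + 1) * (A i / A j) ^ 4)" if m: "m \<in> {s<..k}" for m
  proof -
    have "A (Suc s) \<le> A m" using m s ij by (intro A_mono) auto
    then have "(A s / A m) ^ (4 * k) \<le> (A s / A (Suc s)) ^ (4 * k)"
      using pos by (intro power_mono divide_left_mono) auto
    \<comment> \<open>The power 4 k is spent here: a ratio of at most 1 in the power
      \<open>k\<close> is below its power \<open>j - i\<close>, which \<open>ratio\<close> controls,
      and a fourth power remains.\<close>
    also have "\<dots> = ((A s / A (Suc s)) ^ k) ^ 4"
      by (simp add: power_mult[symmetric] mult.commute)
    also have "\<dots> \<le> ((A s / A (Suc s)) ^ (j - i)) ^ 4"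
    proof (intro power_mono power_decreasing)
      show "A s / A (Suc s) \<le> 1" using A_mono[of s "Suc s"] s ij pos by simp
    qed (use pos ij in auto)
    also have "\<dots> \<le> (A i / A j) ^ 4"
      using ratio pos by (intro power_mono) auto
    finally have "4 ^ (k + 1) * (A s / A m) ^ (4 * k) \<le> 4 ^ (k + 1) * (A i / A j) ^ 4"
      by (rule mult_left_mono) simp
    moreover have "emeasure M (?R m) \<le> ennreal (4 ^ (k + 1) * (A s / A m) ^ (4 * k))"
      using m s ij fs by (intro reject_prob) auto
    ultimately show ?thesis using ennreal_leI order_trans by blast
  qed
  show thesis
  proof (rule that[of B])
    show "B \<in> sets M" unfolding B_def using R by (intro sets.finite_UN) auto
    \<comment> \<open>A vanishing product has a vanishing factor. The rejecting \<open>m\<close> may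
      be any index up to \<open>k\<close>, also beyond \<open>j\<close>, so the union has up to
      \<open>k\<close> members.\<close>
    show "\<omega> \<in> B" if \<omega>: "\<omega> \<in> space M" and zero: "\<And>s. s \<in> {i..<j} \<Longrightarrow> all_indicator T F k n T1 T2 s f \<omega> = 0" for \<omega>
      using zero[of s] s \<omega> by (auto simp: all_indicator_def B_def)
    have "emeasure M B \<le> (\<Sum>m\<in>{s<..k}. emeasure M (?R m))"
      unfolding B_def using R by (intro emeasure_subadditive_finite) auto
    also have "\<dots> \<le> (\<Sum>m\<in>{s<..k}. ennreal (4 ^ (k + 1) * (A i / A j) ^ 4))"
      by (intro sum_mono prob)
    also have "\<dots> = ennreal (real (k - s) * (4 ^ (k + 1) * (A i / A j) ^ 4))"
      using pos by (simp add: ennreal_of_nat_eq_real_of_nat ennreal_mult'[symmetric])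
    also have "\<dots> \<le> ennreal (real k * (4 ^ (k + 1) * (A i / A j) ^ 4))"
      using pos by (intro ennreal_leI mult_right_mono) auto
    finally show "emeasure M B \<le> ennreal (k * 4 ^ (k + 1) * (A i / A j) ^ 4)"
      by (simp add: mult.assoc)
  qed
qed

text \<open>Bias and noise are separated with factor 8, and the sub-Gaussian moment contributes 96:
  776 = 8 + 8 * 96.\<close>

lemma T1_fourth_moment:
  assumes j: "j \<in> {1..k}" and f: "f \<in> F j"
  shows "(\<integral>\<^sup>+\<omega>. ennreal ((T1 j f \<omega> - T f) ^ 4) \<partial>M) \<le> ennreal (776 * A j ^ 4)"
proof -
  let ?w = "omega T (1 / sqrt n) (F j) (F j)" and ?b = "expectation (T1 j f) - T f"
  have w: "0 < ?w" "?w \<le> A j" using omega_pos[OF noise_pos j j] omega_le_A[OF j] by auto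
  note [measurable] = Z1_measurable[OF j, of f]
  have "(\<integral>\<^sup>+\<omega>. ennreal ((T1 j f \<omega> - T f) ^ 4) \<partial>M)
      \<le> (\<integral>\<^sup>+\<omega>. ennreal (8 * ?b ^ 4) + ennreal 8 * ennreal (Z1 j f \<omega> ^ 4) \<partial>M)"
  proof (rule nn_integral_mono)
    fix \<omega>
    have sq: "(x + y)\<^sup>2 \<le> 2 * x\<^sup>2 + 2 * y\<^sup>2" for x y :: real
      using zero_le_power2[of "x - y"] by (simp add: power2_eq_square algebra_simps)
    have four: "x ^ 4 = (x\<^sup>2)\<^sup>2" for x :: real by simp
    have "(x + y) ^ 4 \<le> 8 * x ^ 4 + 8 * y ^ 4" for x y :: real
    proof -
      have "(x + y) ^ 4 \<le> (2 * x\<^sup>2 + 2 * y\<^sup>2)\<^sup>2"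
        unfolding four using sq by (rule power_mono) simp
      also have "\<dots> \<le> 2 * (2 * x\<^sup>2)\<^sup>2 + 2 * (2 * y\<^sup>2)\<^sup>2" by (rule sq)
      finally show ?thesis by simp
    qed
    from this[of ?b "Z1 j f \<omega>"] have "(T1 j f \<omega> - T f) ^ 4 \<le> 8 * ?b ^ 4 + 8 * Z1 j f \<omega> ^ 4"
      by (simp add: Z1_def)
    then show "ennreal ((T1 j f \<omega> - T f) ^ 4) \<le> ennreal (8 * ?b ^ 4) + ennreal 8 * ennreal (Z1 j f \<omega> ^ 4)"
      by (simp add: ennreal_mult'[symmetric] ennreal_plus[symmetric] ennreal_leI del: ennreal_plus ennreal_numeral)
  qed
  also have "\<dots> = ennreal (8 * ?b ^ 4) + ennreal 8 * (\<integral>\<^sup>+\<omega>. ennreal (Z1 j f \<omega> ^ 4) \<partial>M)"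
    by (simp add: nn_integral_add nn_integral_cmult emeasure_space_1)
  also have "\<dots> \<le> ennreal (8 * A j ^ 4) + ennreal 8 * ennreal (96 * A j ^ 4)"
  proof (intro add_mono mult_left_mono zero_le)
    have "\<bar>?b\<bar> \<le> A j" using T1_moments(1)[OF j f] w by simp
    then have "\<bar>?b\<bar> ^ 4 \<le> A j ^ 4" by (rule power_mono) simp
    then show "ennreal (8 * ?b ^ 4) \<le> ennreal (8 * A j ^ 4)" by (simp add: ennreal_leI)
    have "(\<integral>\<^sup>+\<omega>. ennreal (Z1 j f \<omega> ^ 4) \<partial>M) \<le> ennreal (96 * (?w\<^sup>2)\<^sup>2)"
      using w by (intro subgaussian_fourth_moment[OF T1_moments(2)[OF j f]]) simp
    also have "\<dots> \<le> ennreal (96 * A j ^ 4)"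
      using w by (intro ennreal_leI) (simp add: power_mono)
    finally show "(\<integral>\<^sup>+\<omega>. ennreal (Z1 j f \<omega> ^ 4) \<partial>M) \<le> ennreal (96 * A j ^ 4)" .
  qed
  also have "\<dots> = ennreal (776 * A j ^ 4)"
    by (simp add: ennreal_mult'[symmetric] ennreal_plus[symmetric] del: ennreal_plus ennreal_numeral)
  finally show ?thesis .
qed

text \<open>In place of Cauchy-Schwarz, \<open>x^2\<close> is bounded by
  \<open>t + x ^ 4 / t\<close> on the event \<open>B\<close>. This gives a pointwise majorant
  \<open>H\<close> that can be integrated without reference to the selected index.\<close>

lemma overshoot_risk:
  assumes ij: "1 \<le> i" "i < j" "j \<le> k" and f: "f \<in> F i"
  obtains H where "H \<in> borel_measurable M"
    and "\<And>\<omega>. \<omega> \<in> space M \<Longrightarrow> (\<And>s. s \<in> {i..<j} \<Longrightarrow> all_indicator T F k n T1 T2 s f \<omega> = 0)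
      \<Longrightarrow> ennreal ((T1 j f \<omega> - T f)\<^sup>2) \<le> H \<omega>"
    and "(\<integral>\<^sup>+\<omega>. H \<omega> \<partial>M) \<le> ennreal ((k * 4 ^ (k + 1) + 776) * (A i)\<^sup>2)"
proof -
  obtain B where B[measurable]: "B \<in> sets M"
    and in_B: "\<And>\<omega>. \<omega> \<in> space M \<Longrightarrow> (\<And>s. s \<in> {i..<j} \<Longrightarrow> all_indicator T F k n T1 T2 s f \<omega> = 0) \<Longrightarrow> \<omega> \<in> B"
    and prob: "emeasure M B \<le> ennreal (k * 4 ^ (k + 1) * (A i / A j) ^ 4)"
    using overshoot_event[OF ij f] by blast
  have j: "j \<in> {1..k}" and fj: "f \<in> F j" using ij F_mono[of i j] f by auto
  note [measurable] = T1_measurable[OF j, of f]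
  have pos: "0 < A i" "0 < A j" using ij by (auto intro!: A_pos)
  \<comment> \<open>The balancing choice: both \<open>t * (A i / A j) ^ 4\<close> and
    \<open>A j ^ 4 / t\<close> equal \<open>(A i)^2\<close>.\<close>
  define t where "t = A j ^ 4 / (A i)\<^sup>2"
  have t: "0 < t" using pos by (simp add: t_def)
  define H where "H \<omega> = ennreal t * indicator B \<omega> + ennreal (1 / t) * ennreal ((T1 j f \<omega> - T f) ^ 4)" for \<omega>
  show thesis
  proof (rule that[of H])
    show "H \<in> borel_measurable M" unfolding H_def[abs_def] by measurable
  next
    fix \<omega> assume "\<omega> \<in> space M" "\<And>s. s \<in> {i..<j} \<Longrightarrow> all_indicator T F k n T1 T2 s f \<omega> = 0"
    then have "\<omega> \<in> B" by (rule in_B)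
    have "x\<^sup>2 \<le> t + 1 / t * x ^ 4" for x :: real
    proof -
      have "2 * (t * x\<^sup>2) \<le> t\<^sup>2 + (x\<^sup>2)\<^sup>2" using sum_squares_bound[of t "x\<^sup>2"] by (simp add: mult.assoc)
      moreover have "0 \<le> t * x\<^sup>2" using t by simp
      ultimately have "t * x\<^sup>2 \<le> t * t + x ^ 4" by (simp add: power2_eq_square[of t])
      then show ?thesis using t by (simp add: field_simps)
    qed
    with \<open>\<omega> \<in> B\<close> t show "ennreal ((T1 j f \<omega> - T f)\<^sup>2) \<le> H \<omega>"
      unfolding H_def by (simp add: ennreal_mult'[symmetric] ennreal_plus[symmetric] ennreal_leI del: ennreal_plus ennreal_numeral)
  next
    have "(\<integral>\<^sup>+\<omega>. H \<omega> \<partial>M) = ennreal t * emeasure M B + ennreal (1 / t) * (\<integral>\<^sup>+\<omega>. ennreal ((T1 j f \<omega> - T f) ^ 4) \<partial>M)"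
      unfolding H_def by (subst nn_integral_add) (auto simp: nn_integral_cmult)
    also have "\<dots> \<le> ennreal t * ennreal (k * 4 ^ (k + 1) * (A i / A j) ^ 4) + ennreal (1 / t) * ennreal (776 * A j ^ 4)"
      by (intro add_mono mult_left_mono prob T1_fourth_moment[OF j fj] zero_le)
    also have "\<dots> = ennreal (t * (k * 4 ^ (k + 1) * (A i / A j) ^ 4) + 1 / t * (776 * A j ^ 4))"
      using t pos by (simp add: ennreal_mult'[symmetric] ennreal_plus[symmetric] del: ennreal_plus)
    also have "t * (k * 4 ^ (k + 1) * (A i / A j) ^ 4) + 1 / t * (776 * A j ^ 4) = (k * 4 ^ (k + 1) + 776) * (A i)\<^sup>2"
      using pos by (simp add: t_def field_simps eval_nat_numeral)
    finally show "(\<integral>\<^sup>+\<omega>. H \<omega> \<partial>M) \<le> ennreal ((k * 4 ^ (k + 1) + 776) * (A i)\<^sup>2)" .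
  qed
qed

subsection \<open>The selected estimator\<close>

lemma all_indicator_cases: "all_indicator T F k n T1 T2 i f \<omega> \<in> {0, 1}"
proof -
  have "(\<Prod>j\<in>S. pair_indicator T F k n T1 T2 i j f \<omega>) \<in> {0, 1}" if "finite S" for S
    using that by (induction S) (auto simp: pair_indicator_def)
  then show ?thesis by (simp add: all_indicator_def)
qed

lemma T_star_selects:
  obtains j where "j \<in> {1..k}" "T_star T F k n T1 T2 f \<omega> = T1 j f \<omega>"
    "all_indicator T F k n T1 T2 j f \<omega> = 1" "\<And>s. s \<in> {1..<j} \<Longrightarrow> all_indicator T F k n T1 T2 s f \<omega> = 0"
proof -
  let ?I = "\<lambda>i. all_indicator T F k n T1 T2 i f \<omega>"
  define j where "j = (LEAST j. 1 \<le> j \<and> ?I j = 1)"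
  \<comment> \<open>The product for \<open>k\<close> is empty, hence 1; a least accepted index
    therefore exists.\<close>
  have last: "1 \<le> k \<and> ?I k = 1" using k by (simp add: all_indicator_def)
  have j: "1 \<le> j" "?I j = 1" using LeastI[of "\<lambda>j. 1 \<le> j \<and> ?I j = 1", OF last] by (auto simp: j_def)
  have jk: "j \<le> k" unfolding j_def by (rule Least_le[of "\<lambda>j. 1 \<le> j \<and> ?I j = 1", OF last])
  have zero: "?I s = 0" if "s \<in> {1..<j}" for s
    using not_less_Least[of s "\<lambda>j. 1 \<le> j \<and> ?I j = 1"] that all_indicator_cases[of s f \<omega>] by (auto simp: j_def)
  have "(\<Prod>m = 1..<i. 1 - ?I m) * ?I i * T1 i f \<omega> = (if i = j then T1 j f \<omega> else 0)" if "i \<in> {1..k}" for i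
  proof (cases i j rule: linorder_cases)
    case less
    then show ?thesis using zero[of i] that by simp
  next
    case equal
    then show ?thesis using zero j by simp
  next
    case greater
    have "(\<Prod>m = 1..<i. 1 - ?I m) = 0"
      using greater j by (intro prod_zero bexI[of _ j]) auto
    then show ?thesis using greater by simp
  qed
  then have "T_star T F k n T1 T2 f \<omega> = (\<Sum>i = 1..k. if i = j then T1 j f \<omega> else 0)"
    unfolding T_star_def by (intro sum.cong) auto
  also have "\<dots> = T1 j f \<omega>" using j jk by simp
  finally show thesis using that[of j] j jk zero by auto
qed

text \<open>At every outcome the loss is that of some \<open>T1 j\<close>, which lies below a
  majorant attached to \<open>j\<close>. The sum of the majorants over all \<open>j\<close>
  dominates whichever index is selected, so the bound is integrated term by term.\<close>

lemma T_star_risk: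
  assumes i: "i \<in> {1..k}" and f: "f \<in> F i"
  shows "mse M T (T_star T F k n T1 T2) f \<le> ennreal (risk_const k * (A i)\<^sup>2)"
proof -
  let ?G = "\<lambda>j \<omega>. ennreal ((accept_const k * A i + \<bar>Z2 j i f \<omega>\<bar> + \<bar>Z2 i j f \<omega>\<bar>)\<^sup>2)"
  have "\<forall>j\<in>{i<..k}. \<exists>H. H \<in> borel_measurable M
      \<and> (\<forall>\<omega>\<in>space M. (\<forall>s\<in>{i..<j}. all_indicator T F k n T1 T2 s f \<omega> = 0) \<longrightarrow> ennreal ((T1 j f \<omega> - T f)\<^sup>2) \<le> H \<omega>)
      \<and> (\<integral>\<^sup>+\<omega>. H \<omega> \<partial>M) \<le> ennreal ((k * 4 ^ (k + 1) + 776) * (A i)\<^sup>2)"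
  proof
    fix j assume "j \<in> {i<..k}"
    then have "1 \<le> i" "i < j" "j \<le> k" using i by auto
    from overshoot_risk[OF this f] show "\<exists>H. H \<in> borel_measurable M
      \<and> (\<forall>\<omega>\<in>space M. (\<forall>s\<in>{i..<j}. all_indicator T F k n T1 T2 s f \<omega> = 0) \<longrightarrow> ennreal ((T1 j f \<omega> - T f)\<^sup>2) \<le> H \<omega>)
      \<and> (\<integral>\<^sup>+\<omega>. H \<omega> \<partial>M) \<le> ennreal ((k * 4 ^ (k + 1) + 776) * (A i)\<^sup>2)"
      by metis
  qed
  from bchoice[OF this] obtain H where H: "\<forall>j\<in>{i<..k}. H j \<in> borel_measurable M
      \<and> (\<forall>\<omega>\<in>space M. (\<forall>s\<in>{i..<j}. all_indicator T F k n T1 T2 s f \<omega> = 0) \<longrightarrow> ennreal ((T1 j f \<omega> - T f)\<^sup>2) \<le> H j \<omega>)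
      \<and> (\<integral>\<^sup>+\<omega>. H j \<omega> \<partial>M) \<le> ennreal ((k * 4 ^ (k + 1) + 776) * (A i)\<^sup>2)"
    by blast
  have [measurable]: "T1 i f \<in> borel_measurable M" by (rule T1_measurable[OF i])
  have G_meas: "?G j \<in> borel_measurable M" if "j \<in> {1..<i}" for j
  proof -
    have [measurable]: "Z2 i j f \<in> borel_measurable M" "Z2 j i f \<in> borel_measurable M"
      using that i by (auto intro!: Z2_measurable)
    show ?thesis by measurable
  qed
  let ?S = "\<lambda>\<omega>. ennreal ((T1 i f \<omega> - T f)\<^sup>2) + ((\<Sum>j\<in>{1..<i}. ?G j \<omega>) + (\<Sum>j\<in>{i<..k}. H j \<omega>))"
  have "mse M T (T_star T F k n T1 T2) f \<le> (\<integral>\<^sup>+\<omega>. ?S \<omega> \<partial>M)"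
    unfolding mse_def
  proof (rule nn_integral_mono)
    fix \<omega> assume \<omega>: "\<omega> \<in> space M"
    obtain j where j: "j \<in> {1..k}" "T_star T F k n T1 T2 f \<omega> = T1 j f \<omega>"
        "all_indicator T F k n T1 T2 j f \<omega> = 1" "\<And>s. s \<in> {1..<j} \<Longrightarrow> all_indicator T F k n T1 T2 s f \<omega> = 0"
      by (rule T_star_selects[of f \<omega>]) blast
    have "ennreal ((T1 j f \<omega> - T f)\<^sup>2) \<le> ?S \<omega>"
    proof (cases j i rule: linorder_cases)
      case equal
      then show ?thesis by simp
    next
      case less
      have "pair_indicator T F k n T1 T2 j i f \<omega> \<noteq> 0"
        using j(3) less i unfolding all_indicator_def by (metis atLeastAtMost_iff finite_greaterThanAtMost greaterThanAtMost_iff prod_zero zero_neq_one)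
      then have "pair_indicator T F k n T1 T2 j i f \<omega> = 1" by (simp add: pair_indicator_def)
      then have "\<bar>T1 j f \<omega> - T f\<bar> \<le> accept_const k * A i + \<bar>Z2 j i f \<omega>\<bar> + \<bar>Z2 i j f \<omega>\<bar>"
        using less i j(1) f by (intro accepted_error) auto
      then have "\<bar>T1 j f \<omega> - T f\<bar>\<^sup>2 \<le> (accept_const k * A i + \<bar>Z2 j i f \<omega>\<bar> + \<bar>Z2 i j f \<omega>\<bar>)\<^sup>2"
        by (rule power_mono) simp
      then have "ennreal ((T1 j f \<omega> - T f)\<^sup>2) \<le> ?G j \<omega>" by (simp add: ennreal_leI)
      also have "\<dots> \<le> (\<Sum>j\<in>{1..<i}. ?G j \<omega>)" using less j(1) by (intro member_le_sum) auto
      also have "\<dots> \<le> ?S \<omega>" by (simp add: add_increasing add_increasing2)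
      finally show ?thesis .
    next
      case greater
      then have "ennreal ((T1 j f \<omega> - T f)\<^sup>2) \<le> H j \<omega>"
        using H j i \<omega> by auto
      also have "\<dots> \<le> (\<Sum>j\<in>{i<..k}. H j \<omega>)" using greater j(1) by (intro member_le_sum) auto
      also have "\<dots> \<le> ?S \<omega>" by (simp add: add_increasing add_increasing2)
      finally show ?thesis .
    qed
    then show "ennreal ((T_star T F k n T1 T2 f \<omega> - T f)\<^sup>2) \<le> ?S \<omega>" by (simp add: j(2))
  qed
  also have "\<dots> = mse M T (T1 i) f + ((\<Sum>j\<in>{1..<i}. \<integral>\<^sup>+\<omega>. ?G j \<omega> \<partial>M) + (\<Sum>j\<in>{i<..k}. \<integral>\<^sup>+\<omega>. H j \<omega> \<partial>M))"
  proof -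
    have sums: "(\<lambda>\<omega>. \<Sum>j\<in>{1..<i}. ?G j \<omega>) \<in> borel_measurable M" "(\<lambda>\<omega>. \<Sum>j\<in>{i<..k}. H j \<omega>) \<in> borel_measurable M"
      using G_meas H by (intro borel_measurable_sum; blast)+
    have "(\<integral>\<^sup>+\<omega>. ?S \<omega> \<partial>M) = mse M T (T1 i) f + (\<integral>\<^sup>+\<omega>. ((\<Sum>j\<in>{1..<i}. ?G j \<omega>) + (\<Sum>j\<in>{i<..k}. H j \<omega>)) \<partial>M)"
      unfolding mse_def by (rule nn_integral_add[OF _ borel_measurable_add[OF sums]]) measurable
    also have "(\<integral>\<^sup>+\<omega>. ((\<Sum>j\<in>{1..<i}. ?G j \<omega>) + (\<Sum>j\<in>{i<..k}. H j \<omega>)) \<partial>M)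
        = (\<integral>\<^sup>+\<omega>. (\<Sum>j\<in>{1..<i}. ?G j \<omega>) \<partial>M) + (\<integral>\<^sup>+\<omega>. (\<Sum>j\<in>{i<..k}. H j \<omega>) \<partial>M)"
      using sums by (rule nn_integral_add)
    also have "(\<integral>\<^sup>+\<omega>. (\<Sum>j\<in>{1..<i}. ?G j \<omega>) \<partial>M) = (\<Sum>j\<in>{1..<i}. \<integral>\<^sup>+\<omega>. ?G j \<omega> \<partial>M)"
      by (rule nn_integral_sum) (rule G_meas)
    also have "(\<integral>\<^sup>+\<omega>. (\<Sum>j\<in>{i<..k}. H j \<omega>) \<partial>M) = (\<Sum>j\<in>{i<..k}. \<integral>\<^sup>+\<omega>. H j \<omega> \<partial>M)"
      using H by (intro nn_integral_sum) blast
    finally show ?thesis .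
  qed
  also have "\<dots> \<le> ennreal ((A i)\<^sup>2) + ((\<Sum>j\<in>{1..<i}. ennreal ((3 * (accept_const k)\<^sup>2 + 12) * (A i)\<^sup>2))
      + (\<Sum>j\<in>{i<..k}. ennreal ((k * 4 ^ (k + 1) + 776) * (A i)\<^sup>2)))"
  proof (intro add_mono sum_mono)
    show "mse M T (T1 i) f \<le> ennreal ((A i)\<^sup>2)"
      using omega_pos[OF noise_pos i i] omega_le_A[OF i]
      by (intro order_trans[OF T1_moments(3)[OF i f]] ennreal_leI power_mono) auto
  qed (use i H in \<open>auto intro!: accepted_risk\<close>)
  also have "\<dots> = ennreal ((A i)\<^sup>2 + (real (i - 1) * ((3 * (accept_const k)\<^sup>2 + 12) * (A i)\<^sup>2)
      + real (k - i) * ((k * 4 ^ (k + 1) + 776) * (A i)\<^sup>2)))"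
    by (simp add: ennreal_of_nat_eq_real_of_nat ennreal_mult'[symmetric] ennreal_plus[symmetric] del: ennreal_plus)
  also have "\<dots> \<le> ennreal ((A i)\<^sup>2 + (real k * ((3 * (accept_const k)\<^sup>2 + 12) * (A i)\<^sup>2)
      + real k * ((k * 4 ^ (k + 1) + 776) * (A i)\<^sup>2)))"
    using i by (intro ennreal_leI add_mono mult_right_mono) auto
  also have "\<dots> = ennreal (risk_const k * (A i)\<^sup>2)"
    by (simp add: risk_const_def algebra_simps)
  finally show ?thesis .
qed

end

theorem theorem4:
  fixes M :: "'w measure" and W :: "real \<Rightarrow> 'w \<Rightarrow> real"
    and D :: "L2 set" and T :: "L2 \<Rightarrow> real"
    and k :: nat and F :: "nat \<Rightarrow> L2 set"
  assumes noise: "standard_brownian_motion M W"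
    and k: "1 \<le> k"
    and closed: "\<And>i. i \<in> {1..k} \<Longrightarrow> closed (F i)"
    and convex: "\<And>i. i \<in> {1..k} \<Longrightarrow> convex (F i)"
    and nested: "\<And>i. i \<in> {1..<k} \<Longrightarrow> F i \<subseteq> F (Suc i)"
    and linear: "linear_functional_on D T" "F k \<subseteq> D"
    and nonempty: "F 1 \<noteq> {}"
    and finite_modulus: "\<And>\<epsilon>. \<epsilon> > 0 \<Longrightarrow> bdd_above (modulus_diffs T \<epsilon> (F k) (F k))"
    and positive_modulus: "\<And>\<epsilon>. \<epsilon> > 0 \<Longrightarrow> omega T \<epsilon> (F 1) (F 1) > 0"
  shows "\<exists>C>0. \<forall>n\<ge>1. \<forall>T1 T2. building_blocks M W T F k n T1 T2 \<longrightarrow>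
    (SUP f\<in>F 1. mse M T (T_star T F k n T1 T2) f)
      \<le> ennreal (C * (omega T (1 / sqrt n) (F 1) (F 1))\<^sup>2) \<and>
    (\<forall>i\<in>{2..k}. (SUP f\<in>F i. mse M T (T_star T F k n T1 T2) f)
      \<le> ennreal (C * ((MAX m\<in>{1..i - 1}.
            (omega_plus T (sqrt (ln (gamma_plus T F n m i) / n)) (F m) (F i))\<^sup>2)
          + (omega T (1 / sqrt n) (F i) (F i))\<^sup>2)))"
proof -
  interpret nested_spaces T F k D
    using k convex nested linear nonempty finite_modulus positive_modulus by unfold_locales
  have risk_const_pos: "0 < risk_const k"
    unfolding risk_const_def by (intro add_pos_nonneg mult_nonneg_nonneg) auto
  show ?thesis
  \<comment> \<open>The witness is fixed before \<open>n\<close> and the building blocks are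
    introduced, and depends on \<open>k\<close> only.\<close>
  proof (rule exI[of _ "risk_const k"], intro conjI risk_const_pos allI impI ballI)
    fix n :: nat and T1 T2
    assume n: "1 \<le> n" and blocks: "building_blocks M W T F k n T1 T2"
    interpret adaptive_estimation T F k D n M W T1 T2
      using n noise blocks by unfold_locales
    show "(SUP f\<in>F 1. mse M T (T_star T F k n T1 T2) f)
        \<le> ennreal (risk_const k * (omega T (1 / sqrt n) (F 1) (F 1))\<^sup>2)"
      using T_star_risk[of 1] k A_1 by (intro SUP_least) simp
    fix i assume "i \<in> {2..k}"
    then show "(SUP f\<in>F i. mse M T (T_star T F k n T1 T2) f)
      \<le> ennreal (risk_const k * ((MAX m\<in>{1..i - 1}.
            (omega_plus T (sqrt (ln (gamma_plus T F n m i) / n)) (F m) (F i))\<^sup>2)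
          + (omega T (1 / sqrt n) (F i) (F i))\<^sup>2))"
      using T_star_risk[of i] A_square[of i] by (intro SUP_least) simp
  qed
qed

end
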